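(* Let $k>0$, $a>b$, $c>d$ be real numbers, $0\le\theta<\pi$, $U\in SO(2)$, and let $$X=U\begin{pmatrix}e^a&0\\0&e^b\end{pmatrix}U^T,\qquad Y=UR_\theta\begin{pmatrix}e^c&0\\0&e^d\end{pmatrix}R_\theta^TU^T$$ (every pair $X,Y\in \mathrm{Sym}^+(2)$, each with two distinct eigenvalues, can be so written), where $R_\theta=\begin{pmatrix}\cos\theta&-\sin\theta\\ \sin\theta&\cos\theta\end{pmatrix}$. Put $D=\mathrm{diag}(e^a,e^b)$, $$(V_1,\Lambda_1)=(UR_\theta,\mathrm{diag}(e^c,e^d)),\quad (V_2,\Lambda_2)=(UR_{\theta+\pi},\mathrm{diag}(e^c,e^d)),\quad (V_3,\Lambda_3)=(UR_{\theta-\pi/2},\mathrm{diag}(e^d,e^c)),$$ and let $d_i=d_M((U,D),(V_i,\Lambda_i))$, so that $$d_1^2=k\theta^2+(a-c)^2+(b-d)^2,\quad d_2^2=k(\pi-\theta)^2+(a-c)^2+(b-d)^2,\quad d_3^2=k(\theta-\tfrac{\pi}{2})^2+(a-d)^2+(b-c)^2 .$$ Let $m=\frac{2(a-b)(c-d)}{k\pi}$. Then the scaling-rotation distance $d_{\mathcal{SR}}(X,Y)$ is given as follows. (1) If $m>\min(\theta,\pi-\theta)-\pi/4$, then $d_{\mathcal{SR}}(X,Y)$ equals $d_1$ if $\theta<\pi/2$, equals $d_1=d_2$ if $\theta=\pi/2$, and equals $d_2$ if $\theta>\pi/2$. (2) If $m=\min(\theta,\pi-\theta)-\pi/4$, then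 $d_{\mathcal{SR}}(X,Y)$ equals $d_1=d_3$ if $\theta<\pi/2$, equals $d_1=d_2=d_3$ if $\theta=\pi/2$, and equals $d_2=d_3$ if $\theta>\pi/2$. (3) If $m<\min(\theta,\pi-\theta)-\pi/4$, then $d_{\mathcal{SR}}(X,Y)=d_3$. Moreover, in each of these seven subcases, if $I\subset\{1,2,3\}$ is the set of indices $i$ listed for that subcase, then there are exactly $|I|$ minimal smooth scaling-rotation (MSSR) curves from $X$ to $Y$, namely the curves $\chi_i$, $i\in I$, corresponding to the minimal pairs $((U,D),(V_i,\Lambda_i))$. Explicitly, for $t\in[0,1]$, $$\chi_i(t)=(UR_{\theta_i t})\begin{pmatrix}e^{(1-t)a+tc_i}&0\\0&e^{(1-t)b+td_i'}\end{pmatrix}(UR_{\theta_i t})^T,$$ where $\theta_1=\theta$, $\theta_2=\theta-\pi$, $\theta_3=\theta-\pi/2$, $(c_1,d_1')=(c_2,d_2')=(c,d)$ and $(c_3,d_3')=(d,c)$.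
   Context: $\mathrm{Sym}^+(p)$ is the set of real symmetric positive-definite $p\times p$ matrices, $\mathrm{Diag}^+(p)$ the set of diagonal matrices with positive diagonal entries, $M=SO(p)\times\mathrm{Diag}^+(p)$, $F:M\to\mathrm{Sym}^+(p)$, $F(U,D)=UDU^T$, and $\mathcal E_X=F^{-1}(X)$. Here $p=2$. $M$ carries the product Riemannian metric $g_M((A_1,L_1),(A_2,L_2))|_{(U,D)}=-\frac{k}{2}\mathrm{tr}(A_1U^{-1}A_2U^{-1})+\mathrm{tr}(D^{-1}L_1D^{-1}L_2)$ for $A_i\in T_U SO(p)$ and $L_i\in \mathrm{Diag}(p)=T_D\mathrm{Diag}^+(p)$, where $k>0$ is a fixed parameter. Its geodesic distance is $d_M((U,D),(V,\Lambda))^2=\frac k2\|\log(U^{-1}V)\|^2+\|\log(D^{-1}\Lambda)\|^2$, with Frobenius norms, and with $\log R$ ($R\in SO(p)$) an antisymmetric matrix $A$ of smallest norm with $\exp A=R$. The scaling-rotation distance is $d_{\mathcal{SR}}(X,Y)=\inf\{d_M((U,D),(V,\Lambda)):(U,D)\in\mathcal E_X,(V,\Lambda)\in\mathcal E_Y\}$. An $(\mathcal E_X,\mathcal E_Y)$-minimal geodesic is a geodesic $\gamma:[0,1]\to M$ with $\gamma(0)\in\mathcal E_X$, $\gamma(1)\in\mathcal E_Y$ and length $d_{\mathcal{SR}}(X,Y)$; its endpoint pair $(\gamma(0),\gamma(1))$ is a minimal pair. A minimal smooth scaling-rotation (MSSR) curve from $X$ to $Y$ is a curve $\chi=F\circ\gamma$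 with $\gamma$ an $(\mathcal E_X,\mathcal E_Y)$-minimal geodesic; it is said to correspond to the minimal pair formed by the endpoints of $\gamma$. *)

theory Defs
  imports "HOL-Analysis.Analysis"
begin

definition SO :: "(real^'n^'n) set" where
  "SO = {U. rotation_matrix U}"

definition SymPos :: "(real^'n^'n) set" where
  "SymPos = {X. transpose X = X \<and> (\<forall>v. v \<noteq> 0 \<longrightarrow> v \<bullet> (X *v v) > 0)}"

definition DiagPos :: "(real^'n^'n) set" where
  "DiagPos = {D. (\<forall>i j. i \<noteq> j \<longrightarrow> D $ i $ j = 0) \<and> (\<forall>i. D $ i $ i > 0)}"

definition eigenvalues :: "real^'n^'n \<Rightarrow> real set" where
  "eigenvalues X = {l. \<exists>v. v \<noteq> 0 \<and> X *v v = l *\<^sub>R v}"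

type_synonym 'n eigpair = "(real^'n^'n) \<times> (real^'n^'n)"

definition eigM :: "('n::finite) eigpair set" where
  "eigM = SO \<times> DiagPos"

definition eigF :: "('n::finite) eigpair \<Rightarrow> real^'n^'n" where
  "eigF p = fst p ** snd p ** transpose (fst p)"

definition fiber :: "real^'n^'n \<Rightarrow> ('n::finite) eigpair set" where
  "fiber X = {p \<in> eigM. eigF p = X}"

definition metricM ::
  "real \<Rightarrow> ('n::finite) eigpair \<Rightarrow> ('n::finite) eigpair \<Rightarrow> ('n::finite) eigpair \<Rightarrow> real" where
  "metricM k p v w =
     - (k / 2) * trace (fst v ** matrix_inv (fst p) ** fst w ** matrix_inv (fst p))
     + trace (matrix_inv (snd p) ** snd v ** matrix_inv (snd p) ** snd w)"

(* Curves are total functions on the reals of which only the restriction to [0,1] matters;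
   derivatives at 0 and 1 are one-sided. *)
definition C1_curveM :: "(real \<Rightarrow> ('n::finite) eigpair) \<Rightarrow> bool" where
  "C1_curveM \<gamma> \<longleftrightarrow> \<gamma> ` {0..1} \<subseteq> eigM \<and>
     (\<exists>\<gamma>'. continuous_on {0..1} \<gamma>' \<and>
        (\<forall>t\<in>{0..1}. (\<gamma> has_vector_derivative \<gamma>' t) (at t within {0..1})))"

definition curve_lengthM :: "real \<Rightarrow> (real \<Rightarrow> ('n::finite) eigpair) \<Rightarrow> real" where
  "curve_lengthM k \<gamma> = integral {0..1}
     (\<lambda>t. sqrt (metricM k (\<gamma> t) (vector_derivative \<gamma> (at t within {0..1}))
                                (vector_derivative \<gamma> (at t within {0..1}))))"

(* Riemannian distance. Curves may have vanishing velocity, so a piecewise C1 curve becomes C1,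
   with the same length, after a reparametrisation that stops at its corners; the infimum over
   C1 curves is therefore the infimum over piecewise C1 curves. *)
definition distM ::
  "real \<Rightarrow> ('n::finite) eigpair \<Rightarrow> ('n::finite) eigpair \<Rightarrow> real" where
  "distM k p q = Inf {curve_lengthM k \<gamma> | \<gamma>. C1_curveM \<gamma> \<and> \<gamma> 0 = p \<and> \<gamma> 1 = q}"

(* Affinely parametrised, locally distance-minimising; c is the constant speed, and c = 0 gives
   the constant geodesics. *)
definition geodesicM :: "real \<Rightarrow> (real \<Rightarrow> ('n::finite) eigpair) \<Rightarrow> bool" where
  "geodesicM k \<gamma> \<longleftrightarrow> C1_curveM \<gamma> \<and>
     (\<exists>c. \<forall>t\<in>{0..1}. \<exists>e>0. \<forall>r\<in>{0..1} \<inter> ball t e. \<forall>s\<in>{0..1} \<inter> ball t e.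
        distM k (\<gamma> r) (\<gamma> s) = c * \<bar>r - s\<bar>)"

definition dist_SR :: "real \<Rightarrow> real^'n^'n \<Rightarrow> real^'n^'n \<Rightarrow> real" where
  "dist_SR k X Y = Inf {distM k p q | p q. p \<in> fiber X \<and> q \<in> fiber Y}"

definition minimal_geodesic ::
  "real \<Rightarrow> real^'n^'n \<Rightarrow> real^'n^'n \<Rightarrow> (real \<Rightarrow> ('n::finite) eigpair) \<Rightarrow> bool" where
  "minimal_geodesic k X Y \<gamma> \<longleftrightarrow> geodesicM k \<gamma> \<and> \<gamma> 0 \<in> fiber X \<and> \<gamma> 1 \<in> fiber Y \<and>
     curve_lengthM k \<gamma> = dist_SR k X Y"

definition minimal_pair ::
  "real \<Rightarrow> real^'n^'n \<Rightarrow> real^'n^'n \<Rightarrow> ('n::finite) eigpair \<Rightarrow> ('n::finite) eigpair \<Rightarrow> bool" where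
  "minimal_pair k X Y p q \<longleftrightarrow> (\<exists>\<gamma>. minimal_geodesic k X Y \<gamma> \<and> \<gamma> 0 = p \<and> \<gamma> 1 = q)"

(* The curve is restricted to [0,1], so that equality of MSSR curves is equality on [0,1]. *)
definition MSSR_corresponds ::
  "real \<Rightarrow> real^'n^'n \<Rightarrow> real^'n^'n \<Rightarrow> ('n::finite) eigpair \<Rightarrow> ('n::finite) eigpair
     \<Rightarrow> (real \<Rightarrow> real^'n^'n) \<Rightarrow> bool" where
  "MSSR_corresponds k X Y p q chi \<longleftrightarrow>
     (\<exists>\<gamma>. minimal_geodesic k X Y \<gamma> \<and> \<gamma> 0 = p \<and> \<gamma> 1 = q \<and> chi = restrict (eigF \<circ> \<gamma>) {0..1})"

definition MSSR_curves :: "real \<Rightarrow> real^'n^'n \<Rightarrow> real^'n^'n \<Rightarrow> (real \<Rightarrow> real^'n^'n) set" where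
  "MSSR_curves k X Y = {restrict (eigF \<circ> \<gamma>) {0..1} | \<gamma>. minimal_geodesic k X Y \<gamma>}"

definition diag2 :: "real \<Rightarrow> real \<Rightarrow> real^2^2" where
  "diag2 x y = vector [vector [x, 0], vector [0, y]]"

definition Rot :: "real \<Rightarrow> real^2^2" where
  "Rot t = vector [vector [cos t, - sin t], vector [sin t, cos t]]"

end

theory Submission
  imports Defs
begin

text \<open>
  The manifold \<open>SO(2) \<times> Diag\<^sup>+(2)\<close> is flat: the map
  \<open>(p, x, y) \<mapsto> (Rot (p / sqrt k), diag2 (exp x) (exp y))\<close> from Euclidean \<open>\<real>\<^sup>3\<close>, called
  \<open>chart k\<close> below, is a Riemannian covering (\<open>metricM_chart_deriv\<close>), and every \<open>C\<^sup>1\<close> curve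
  lifts along it with its length (\<open>C1_curve_lift\<close>, \<open>curve_via_chart\<close>). Hence all
  questions about lengths become questions about segments in \<open>\<real>\<^sup>3\<close>, up to the choice of a lift of the
  endpoints: a curve of minimal length between two fibres that has locally constant speed is the image
  of a segment run through at constant speed (\<open>minimal_geodesic_is_chart_segment\<close>).

  A symmetric matrix with distinct eigenvalues determines its eigen-decomposition up to rotating the
  frame by a multiple of \<open>\<pi>/2\<close> and swapping the eigenvalues at each odd multiple. Upstairs this is the
  action of \<open>\<int>\<close> by the isometries \<open>turn k n\<close>, so the set of all lifts of a fibre is one orbit
  (\<open>fiber_eigF_chart\<close>). Let \<open>v\<close> and \<open>w\<close> be lifts of the given decompositions of \<open>X\<close> and \<open>Y\<close>.
  Because the action is isometric, the scaling-rotation distance is the minimum over a single integer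
  \<open>n\<close> of \<open>norm (v - turn k n w)\<close>, and up to the action, which does not change the curve in the space of
  symmetric matrices, the minimal geodesics are the images of the segments from \<open>v\<close> to \<open>turn k n w\<close>
  with \<open>n\<close> a minimiser (\<open>MSSR_curves_optimal\<close>, \<open>MSSR_corresponds_optimal\<close>).

  What remains is elementary. The squared norm is \<open>sq_dist\<close>, an explicit function of \<open>n\<close>; its minimisers
  lie in \<open>{0, -2, -1}\<close>, and these three integers give the pairs \<open>(V\<^sub>i, \<Lambda>\<^sub>i)\<close> for \<open>i = 1, 2, 3\<close>.
  Pairwise comparison of the three values turns into comparison of \<open>m\<close> with
  \<open>\<theta> - \<pi>/4\<close> and \<open>\<pi> - \<theta> - \<pi>/4\<close>, and of \<open>\<theta>\<close> with \<open>\<pi>/2\<close> (\<open>optimal_eq\<close>). Distinct minimisers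
  give distinct curves since these already differ at \<open>t = 1/2\<close> (\<open>joining_inj\<close>).
\<close>

section \<open>Two by two matrices\<close>

lemma Rot_nth [simp]:
  "Rot t $ 1 $ 1 = cos t" "Rot t $ 1 $ 2 = - sin t" "Rot t $ 2 $ 1 = sin t" "Rot t $ 2 $ 2 = cos t"
  by (simp_all add: Rot_def)

lemma diag2_nth [simp]:
  "diag2 x y $ 1 $ 1 = x" "diag2 x y $ 1 $ 2 = 0" "diag2 x y $ 2 $ 1 = 0" "diag2 x y $ 2 $ 2 = y"
  by (simp_all add: diag2_def)

lemma matrix2_eq_iff:
  fixes A B :: "real^2^2"
  shows "A = B \<longleftrightarrow> A$1$1 = B$1$1 \<and> A$1$2 = B$1$2 \<and> A$2$1 = B$2$1 \<and> A$2$2 = B$2$2"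
  by (auto simp: vec_eq_iff forall_2)

lemma matrix2_mult_nth:
  fixes A B :: "real^2^2"
  shows "(A ** B) $ i $ j = A$i$1 * B$1$j + A$i$2 * B$2$j"
  by (simp add: matrix_matrix_mult_def sum_2)

lemma transpose_nth: "transpose A $ i $ j = A $ j $ i"
  by (simp add: transpose_def)

lemma mat2_nth: "(mat 1 :: real^2^2) $ 1 $ 1 = 1" "(mat 1 :: real^2^2) $ 1 $ 2 = 0"
   "(mat 1 :: real^2^2) $ 2 $ 1 = 0" "(mat 1 :: real^2^2) $ 2 $ 2 = 1"
  by (auto simp: mat_def)

lemmas matrix2 = matrix2_eq_iff matrix2_mult_nth transpose_nth mat2_nth

lemma Rot_add: "Rot (s + t) = Rot s ** Rot t"
  by (simp add: matrix2 cos_add sin_add)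

lemma Rot_eq_iff: "Rot s = Rot t \<longleftrightarrow> (\<exists>n::int. s = t + 2 * pi * n)"
  by (subst sin_cos_eq_iff [symmetric]) (auto simp: matrix2)

lemma SO_Rot: "U \<in> SO \<longleftrightarrow> (\<exists>u. U = Rot u)"
proof
  assume "U \<in> SO"
  then have "transpose U ** U = mat 1" "U ** transpose U = mat 1" "det U = 1"
    by (auto simp: SO_def rotation_matrix_def orthogonal_matrix_def)
  then have o: "U$1$1 * U$1$1 + U$2$1 * U$2$1 = 1" "U$1$1 * U$1$2 + U$2$1 * U$2$2 = 0"
    "U$1$2 * U$1$2 + U$2$2 * U$2$2 = 1" and d: "U$1$1 * U$2$2 - U$1$2 * U$2$1 = 1"
    by (auto simp: matrix2 det_2)
  \<comment> \<open>Half the squared Frobenius distance of \<open>U\<close> from its cofactor matrix.\<close>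
  have "(U$1$1 - U$2$2)\<^sup>2 + (U$1$2 + U$2$1)\<^sup>2 = 0"
    using o d by (simp add: power2_eq_square algebra_simps)
  then have e: "U$2$2 = U$1$1" "U$1$2 = - U$2$1"
    by (auto simp: sum_power2_eq_zero_iff)
  obtain u where "U$1$1 = cos u" "U$2$1 = sin u"
    using o(1) sincos_total_2pi [of "U$1$1" "U$2$1"] by (auto simp: power2_eq_square)
  then show "\<exists>u. U = Rot u"
    using e by (auto simp: matrix2)
next
  assume "\<exists>u. U = Rot u"
  then show "U \<in> SO"
    by (auto simp: SO_def rotation_matrix_def orthogonal_matrix_def det_2 matrix2 
        simp flip: power2_eq_square)
qed

lemma DiagPos_diag2: "B \<in> DiagPos \<longleftrightarrow> (\<exists>x y. B = diag2 (exp x) (exp y))"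
proof
  assume B: "B \<in> DiagPos"
  then have "B = diag2 (exp (ln (B$1$1))) (exp (ln (B$2$2)))"
    by (auto simp: DiagPos_def matrix2 forall_2)
  then show "\<exists>x y. B = diag2 (exp x) (exp y)" by blast
next
  assume "\<exists>x y. B = diag2 (exp x) (exp y)"
  then show "B \<in> DiagPos"
    by (auto simp: DiagPos_def forall_2)
qed

lemma matrix_inv_unique:
  fixes A B :: "'a::semiring_1^'n^'n"
  assumes "A ** B = mat 1" "B ** A = mat 1"
  shows "matrix_inv A = B"
  unfolding matrix_inv_def
proof (rule some_equality)
  show "A ** B = mat 1 \<and> B ** A = mat 1" using assms by blast
next
  fix C assume "A ** C = mat 1 \<and> C ** A = mat 1"
  then have "C ** A ** B = B" by simp
  then show "C = B" using assms by (simp flip: matrix_mul_assoc)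
qed

lemma matrix_inv_Rot: "matrix_inv (Rot t) = Rot (- t)"
  by (rule matrix_inv_unique) (auto simp: matrix2 simp flip: power2_eq_square)

lemma matrix_inv_diag2:
  assumes "x \<noteq> 0" "y \<noteq> 0"
  shows "matrix_inv (diag2 x y) = diag2 (inverse x) (inverse y)"
  by (rule matrix_inv_unique) (use assms in \<open>auto simp: matrix2\<close>)

text \<open>The symmetric matrix with eigenvalues \<open>s + r\<close> and \<open>s - r\<close> whose eigenvector for \<open>s + r\<close> has
  angle \<open>\<alpha> / 2\<close>. In these coordinates the ambiguity of the eigen-decomposition is the one of polar
  coordinates \<open>(r, \<alpha>)\<close> with signed radius.\<close>

definition symm2 :: "real \<Rightarrow> real \<Rightarrow> real \<Rightarrow> real^2^2" where
  "symm2 s r \<alpha> = vector [vector [s + r * cos \<alpha>, r * sin \<alpha>], vector [r * sin \<alpha>, s - r * cos \<alpha>]]"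

lemma symm2_nth [simp]:
  "symm2 s r \<alpha> $ 1 $ 1 = s + r * cos \<alpha>" "symm2 s r \<alpha> $ 1 $ 2 = r * sin \<alpha>"
  "symm2 s r \<alpha> $ 2 $ 1 = r * sin \<alpha>" "symm2 s r \<alpha> $ 2 $ 2 = s - r * cos \<alpha>"
  by (simp_all add: symm2_def)

lemma Rot_conj_diag2:
  "Rot t ** diag2 x y ** transpose (Rot t) = symm2 ((x + y) / 2) ((x - y) / 2) (2 * t)"
proof -
  have half: "c\<^sup>2 * x + s\<^sup>2 * y = (x + y) / 2 + (x - y) / 2 * (c\<^sup>2 - s\<^sup>2)"
    if "s\<^sup>2 + c\<^sup>2 = 1" for s c x y :: real
  proof -
    have "x + y = (s\<^sup>2 + c\<^sup>2) * (x + y)" using that by simp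
    then show ?thesis by (simp add: algebra_simps add_divide_distrib diff_divide_distrib)
  qed
  show ?thesis
    using half [of "sin t" "cos t" x y] half [of "cos t" "sin t" y x]
    unfolding power2_eq_square
    by (simp add: matrix2 cos_double sin_double power2_eq_square)
       (simp add: algebra_simps add_divide_distrib diff_divide_distrib)
qed

lemma symm2_eq_iff:
  assumes "r \<noteq> 0"
  shows "symm2 s r \<alpha> = symm2 s' r' \<beta> \<longleftrightarrow> s = s' \<and> 
    (r' = r \<and> (\<exists>n::int. \<beta> = \<alpha> + 2 * pi * n) \<or> r' = - r \<and> (\<exists>n::int. \<beta> = \<alpha> + pi + 2 * pi * n))"
    (is "?L \<longleftrightarrow> ?R")
proof
  assume ?L
  then have s: "s = s'" and c: "r * cos \<alpha> = r' * cos \<beta>" and n: "r * sin \<alpha> = r' * sin \<beta>"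
    by (auto simp: matrix2)
  have "r\<^sup>2 = (r * cos \<alpha>)\<^sup>2 + (r * sin \<alpha>)\<^sup>2" "r'\<^sup>2 = (r' * cos \<beta>)\<^sup>2 + (r' * sin \<beta>)\<^sup>2"
    by (simp_all add: power_mult_distrib flip: distrib_left)
  then have "r'\<^sup>2 = r\<^sup>2" using c n by simp
  then have "r' = r \<or> r' = - r" by (simp add: power2_eq_iff)
  then show ?R
  proof
    assume "r' = r"
    with c n assms have "sin \<beta> = sin \<alpha> \<and> cos \<beta> = cos \<alpha>" by auto
    then show ?R using s \<open>r' = r\<close> by (auto simp: sin_cos_eq_iff)
  next
    assume "r' = - r"
    with c n assms have "r * (cos \<alpha> + cos \<beta>) = 0" "r * (sin \<alpha> + sin \<beta>) = 0" 
      by (auto simp: algebra_simps)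
    with assms have "sin \<beta> = sin (\<alpha> + pi) \<and> cos \<beta> = cos (\<alpha> + pi)" by auto
    then show ?R using s \<open>r' = - r\<close> unfolding sin_cos_eq_iff by auto
  qed
next
  assume ?R
  moreover have "sin \<beta> = sin \<alpha> \<and> cos \<beta> = cos \<alpha>" if "\<beta> = \<alpha> + 2 * pi * real_of_int n" for n
    using that sin_cos_eq_iff [of \<beta> \<alpha>] by auto
  moreover have "sin \<beta> = - sin \<alpha> \<and> cos \<beta> = - cos \<alpha>" if "\<beta> = \<alpha> + pi + 2 * pi * real_of_int n" for n
    using that sin_cos_eq_iff [of \<beta> "\<alpha> + pi"] by auto
  ultimately show ?L by (auto simp: matrix2)
qed

section \<open>A flat covering of the manifold of eigen-decompositions\<close>

text \<open>The first coordinate is the rotation angle scaled by \<open>sqrt k\<close>, and the other two are the logarithms of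
  the eigenvalues; with this scaling the metric pulls back to the standard one on \<open>\<real>\<^sup>3\<close>.\<close>

definition chart :: "real \<Rightarrow> real \<times> real \<times> real \<Rightarrow> 2 eigpair" where
  "chart k v = (Rot (fst v / sqrt k), diag2 (exp (fst (snd v))) (exp (snd (snd v))))"

lemma chart_in_eigM: "chart k v \<in> eigM"
  unfolding chart_def eigM_def by (auto simp: SO_Rot DiagPos_diag2)

lemma eigM_chartE:
  assumes "k > 0" "p \<in> eigM"
  obtains v where "p = chart k v"
proof -
  obtain u x y where "p = (Rot u, diag2 (exp x) (exp y))"
    using assms by (auto simp: eigM_def SO_Rot DiagPos_diag2)
  then have "p = chart k (sqrt k * u, x, y)" using assms(1) by (simp add: chart_def)
  then show ?thesis by (rule that)
qed

text \<open>The deck transformations of the covering are the full turns of the frame.\<close>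

lemma chart_eq_iff:
  assumes "k > 0"
  shows "chart k v = chart k w \<longleftrightarrow> snd v = snd w \<and> (\<exists>n::int. fst v = fst w + sqrt k * (2 * pi * n))"
    (is "_ \<longleftrightarrow> ?R")
proof -
  have "chart k v = chart k w \<longleftrightarrow> 
      Rot (fst v / sqrt k) = Rot (fst w / sqrt k) \<and> snd v = snd w"
    by (auto simp: chart_def matrix2_eq_iff prod_eq_iff)
  also have "\<dots> \<longleftrightarrow> ?R"
    using assms by (auto simp: Rot_eq_iff field_simps)
  finally show ?thesis .
qed

lemma norm_prod3: "(norm v)\<^sup>2 = (fst v)\<^sup>2 + (fst (snd v))\<^sup>2 + (snd (snd v))\<^sup>2"
  for v :: "real \<times> real \<times> real"
  by (simp add: norm_prod_def)

text \<open>Written as combinations of constant matrices, both factors of the chart can be differentiated by the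
  rules for scalar functions.\<close>

lemma Rot_combination: "Rot t = cos t *\<^sub>R mat 1 + sin t *\<^sub>R Rot (pi / 2)"
  by (simp add: matrix2)

lemma diag2_combination: "diag2 x y = x *\<^sub>R diag2 1 0 + y *\<^sub>R diag2 0 1"
  by (simp add: matrix2)

text \<open>The differential of \<open>chart k\<close> at \<open>v\<close>, applied to \<open>w\<close>.\<close>

definition chart_deriv :: "real \<Rightarrow> real \<times> real \<times> real \<Rightarrow> real \<times> real \<times> real \<Rightarrow> 2 eigpair" where
  "chart_deriv k v w = 
    ((fst w / sqrt k) *\<^sub>R (cos (fst v / sqrt k) *\<^sub>R Rot (pi / 2) - sin (fst v / sqrt k) *\<^sub>R mat 1),
     diag2 (exp (fst (snd v)) * fst (snd w)) (exp (snd (snd v)) * snd (snd w)))"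

lemma has_vector_derivative_chart:
  assumes "(v has_vector_derivative w) (at t within S)"
  shows "((\<lambda>t. chart k (v t)) has_vector_derivative chart_deriv k (v t) w) (at t within S)"
proof -
  have 1: "((\<lambda>t. fst (v t)) has_vector_derivative fst w) (at t within S)"
    and 2: "((\<lambda>t. fst (snd (v t))) has_vector_derivative fst (snd w)) (at t within S)"
    and 3: "((\<lambda>t. snd (snd (v t))) has_vector_derivative snd (snd w)) (at t within S)"
    using assms by (auto intro!: bounded_linear.has_vector_derivative [OF bounded_linear_fst]
        bounded_linear.has_vector_derivative [OF bounded_linear_snd])
  note d = 1 [folded has_real_derivative_iff_has_vector_derivative]
    2 [folded has_real_derivative_iff_has_vector_derivative]
    3 [folded has_real_derivative_iff_has_vector_derivative]
  have lin: "((\<lambda>t. f t *\<^sub>R A) has_vector_derivative f' *\<^sub>R A) (at t within S)"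
    if "(f has_real_derivative f') (at t within S)" for f f' and A :: "real^2^2"
    using bounded_linear.has_vector_derivative [OF bounded_linear_scaleR_left] that
    by (simp add: has_real_derivative_iff_has_vector_derivative)
  note DERIV_chain2 [OF DERIV_cos DERIV_cdivide [OF d(1)], of "sqrt k"]
    DERIV_chain2 [OF DERIV_sin DERIV_cdivide [OF d(1)], of "sqrt k"]
  from has_vector_derivative_add [OF lin [OF this(1)] lin [OF this(2)]]
  have "((\<lambda>t. Rot (fst (v t) / sqrt k)) has_vector_derivative fst (chart_deriv k (v t) w)) (at t within S)"
    unfolding Rot_combination [of "fst (v _) / sqrt k"]
    by (rule has_vector_derivative_eq_rhs) (simp add: chart_deriv_def algebra_simps)
  moreover have "((\<lambda>t. diag2 (exp (fst (snd (v t)))) (exp (snd (snd (v t))))) 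
      has_vector_derivative snd (chart_deriv k (v t) w)) (at t within S)"
    unfolding diag2_combination [of "exp _" "exp _"]
    by (rule has_vector_derivative_eq_rhs [OF has_vector_derivative_add
          [OF lin [OF DERIV_chain2 [OF DERIV_exp d(2)]] lin [OF DERIV_chain2 [OF DERIV_exp d(3)]]]])
       (simp add: chart_deriv_def matrix2)
  ultimately show ?thesis
    unfolding chart_def using has_vector_derivative_Pair by fastforce
qed

text \<open>A tangent vector \<open>A\<close> at a rotation \<open>U\<close> satisfies \<open>A U\<^sup>-\<^sup>1 = q J\<close> with \<open>J\<close> the rotation by
  \<open>\<pi>/2\<close>, and \<open>J\<^sup>2 = - 1\<close>; so the trace term is \<open>k q\<^sup>2\<close>, where \<open>q\<close> is the angular velocity.\<close>

lemma metricM_chart_deriv: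
  assumes "k > 0"
  shows "metricM k (chart k v) (chart_deriv k v w) (chart_deriv k v w) = (norm w)\<^sup>2"
proof -
  define q where "q = fst w / sqrt k"
  define s where "s = sin (fst v / sqrt k)"
  define c where "c = cos (fst v / sqrt k)"
  have sc: "s * s + c * c = 1" unfolding s_def c_def by (simp flip: power2_eq_square)
  let ?A = "q *\<^sub>R (c *\<^sub>R Rot (pi / 2) - s *\<^sub>R mat 1)" and ?R = "Rot (- (fst v / sqrt k))"
  have AR: "?A ** ?R = q *\<^sub>R Rot (pi / 2)"
    using sc by (simp add: matrix2 flip: s_def c_def) algebra
  have "trace (?A ** ?R ** ?A ** ?R) = trace ((?A ** ?R) ** (?A ** ?R))"
    by (simp only: matrix_mul_assoc)
  also have "\<dots> = - 2 * q\<^sup>2"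
    unfolding AR by (simp add: trace_def sum_2 matrix2 power2_eq_square)
  finally have "- (k / 2) * trace (?A ** ?R ** ?A ** ?R) = (fst w)\<^sup>2"
    using assms by (simp add: q_def power_divide)
  then show ?thesis
    by (simp add: metricM_def chart_def chart_deriv_def matrix_inv_Rot matrix_inv_diag2 norm_prod3
     flip: s_def c_def q_def) (simp add: trace_def sum_2 matrix2 power2_eq_square field_simps)
qed

section \<open>Lifting curves\<close>

lemma curve_via_chart:
  assumes k: "k > 0"
    and \<gamma>: "\<And>t. t \<in> {0..1} \<Longrightarrow> \<gamma> t = chart k (v t)"
    and v: "\<And>t. t \<in> {0..1} \<Longrightarrow> (v has_vector_derivative v' t) (at t within {0..1})"
    and v': "continuous_on {0..1} v'"
  shows "C1_curveM \<gamma>" and "curve_lengthM k \<gamma> = integral {0..1} (\<lambda>t. norm (v' t))"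
proof -
  have d: "(\<gamma> has_vector_derivative chart_deriv k (v t) (v' t)) (at t within {0..1})"
    if "t \<in> {0..1}" for t
    by (rule has_vector_derivative_transform [OF that \<gamma> has_vector_derivative_chart [OF v [OF that]]])
  have [continuous_intros]: "continuous_on {0..1} v"
    using v by (rule continuous_on_vector_derivative)
  note v' [continuous_intros]
  have "continuous_on {0..1} (\<lambda>t. chart_deriv k (v t) (v' t))"
    unfolding chart_deriv_def diag2_combination [of "exp _ * _"] using k
    by (intro continuous_intros) auto
  then show "C1_curveM \<gamma>"
    unfolding C1_curveM_def using d \<gamma> by (auto simp: chart_in_eigM)
  show "curve_lengthM k \<gamma> = integral {0..1} (\<lambda>t. norm (v' t))"
    unfolding curve_lengthM_def
  proof (rule integral_cong)
    fix t :: real assume t: "t \<in> {0..1}"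
    then have "vector_derivative \<gamma> (at t within {0..1}) = chart_deriv k (v t) (v' t)"
      by (intro vector_derivative_within_closed_interval d) auto
    then show "sqrt (metricM k (\<gamma> t) (vector_derivative \<gamma> (at t within {0..1}))
        (vector_derivative \<gamma> (at t within {0..1}))) = norm (v' t)"
      using t k by (simp add: \<gamma> metricM_chart_deriv)
  qed
qed

text \<open>The angle of the lift is the integral of the angular velocity \<open>\<omega>\<close> of the rotation factor. That this
  angle really describes the curve follows since the rotation factor, turned back by the angle, has
  derivative zero.\<close>

lemma C1_curve_lift:
  assumes k: "k > 0" and C1: "C1_curveM \<gamma>" and \<gamma>0: "\<gamma> 0 = chart k v0"
  obtains v v' where "v 0 = v0"
    and "\<And>t. t \<in> {0..1} \<Longrightarrow> \<gamma> t = chart k (v t)"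
    and "\<And>t. t \<in> {0..1} \<Longrightarrow> (v has_vector_derivative v' t) (at t within {0..1})"
    and "continuous_on {0..1} v'"
proof -
  obtain \<gamma>' where c': "continuous_on {0..1} \<gamma>'"
    and d: "\<And>t. t \<in> {0..1} \<Longrightarrow> (\<gamma> has_vector_derivative \<gamma>' t) (at t within {0..1})"
    and M: "\<And>t. t \<in> {0..1} \<Longrightarrow> \<gamma> t \<in> eigM"
    using C1 unfolding C1_curveM_def by blast
  have c: "continuous_on {0..1} \<gamma>"
    using d by (rule continuous_on_vector_derivative)
  define \<alpha> \<beta> x y where "\<alpha> = (\<lambda>t. fst (\<gamma> t) $ 1 $ 1)" and "\<beta> = (\<lambda>t. fst (\<gamma> t) $ 2 $ 1)"
    and "x = (\<lambda>t. snd (\<gamma> t) $ 1 $ 1)" and "y = (\<lambda>t. snd (\<gamma> t) $ 2 $ 2)"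
  define \<alpha>' \<beta>' x' y' where "\<alpha>' = (\<lambda>t. fst (\<gamma>' t) $ 1 $ 1)" and "\<beta>' = (\<lambda>t. fst (\<gamma>' t) $ 2 $ 1)"
    and "x' = (\<lambda>t. snd (\<gamma>' t) $ 1 $ 1)" and "y' = (\<lambda>t. snd (\<gamma>' t) $ 2 $ 2)"
  have f: "((\<lambda>t. fst (\<gamma> t) $ i $ j) has_real_derivative fst (\<gamma>' t) $ i $ j) (at t within {0..1})"
    and s: "((\<lambda>t. snd (\<gamma> t) $ i $ j) has_real_derivative snd (\<gamma>' t) $ i $ j) (at t within {0..1})"
    if "t \<in> {0..1}" for t i j
    unfolding has_real_derivative_iff_has_vector_derivative using d [OF that]
    by (auto intro!: bounded_linear.has_vector_derivative [OF bounded_linear_fst]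
        bounded_linear.has_vector_derivative [OF bounded_linear_snd]
        bounded_linear.has_vector_derivative [OF bounded_linear_vec_nth])
  have e: "(\<alpha> has_real_derivative \<alpha>' t) (at t within {0..1})"
      "(\<beta> has_real_derivative \<beta>' t) (at t within {0..1})"
      "(x has_real_derivative x' t) (at t within {0..1})"
      "(y has_real_derivative y' t) (at t within {0..1})"
    if "t \<in> {0..1}" for t
    using f [OF that] s [OF that] by (simp_all add: \<alpha>_def \<alpha>'_def \<beta>_def \<beta>'_def x_def x'_def y_def y'_def)
  note e [derivative_intros]
  have cont: "continuous_on {0..1} \<alpha>" "continuous_on {0..1} \<beta>" "continuous_on {0..1} x" 
    "continuous_on {0..1} y" "continuous_on {0..1} \<alpha>'" "continuous_on {0..1} \<beta>'" 
    "continuous_on {0..1} x'" "continuous_on {0..1} y'"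
    unfolding \<alpha>_def \<alpha>'_def \<beta>_def \<beta>'_def x_def x'_def y_def y'_def
    by (intro continuous_intros c c')+
  note cont [continuous_intros]
  have rot: "fst (\<gamma> t) $ 1 $ 2 = - \<beta> t" "fst (\<gamma> t) $ 2 $ 2 = \<alpha> t" 
    "\<alpha> t * \<alpha> t + \<beta> t * \<beta> t = 1" "x t > 0" "y t > 0"
    "snd (\<gamma> t) $ 1 $ 2 = 0" "snd (\<gamma> t) $ 2 $ 1 = 0" if t: "t \<in> {0..1}" for t
  proof -
    obtain w where "\<gamma> t = chart k w" using eigM_chartE [OF k M [OF t]] .
    then show "fst (\<gamma> t) $ 1 $ 2 = - \<beta> t" "fst (\<gamma> t) $ 2 $ 2 = \<alpha> t" 
      "\<alpha> t * \<alpha> t + \<beta> t * \<beta> t = 1" "x t > 0" "y t > 0"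
      "snd (\<gamma> t) $ 1 $ 2 = 0" "snd (\<gamma> t) $ 2 $ 1 = 0"
      by (auto simp: \<alpha>_def \<beta>_def x_def y_def chart_def simp flip: power2_eq_square)
  qed
  define \<omega> where "\<omega> = (\<lambda>t. \<alpha> t * \<beta>' t - \<beta> t * \<alpha>' t)"
  have tangent: "\<alpha>' t = - \<beta> t * \<omega> t \<and> \<beta>' t = \<alpha> t * \<omega> t" if t: "t \<in> {0..1}" for t
  proof -
    have d1: "((\<lambda>t. \<alpha> t * \<alpha> t + \<beta> t * \<beta> t) has_vector_derivative 
        (\<alpha>' t * \<alpha> t + \<alpha>' t * \<alpha> t) + (\<beta>' t * \<beta> t + \<beta>' t * \<beta> t)) (at t within {0..1})"
      unfolding has_real_derivative_iff_has_vector_derivative [symmetric]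
      using t by (auto intro!: derivative_eq_intros)
    have d2: "((\<lambda>t. \<alpha> t * \<alpha> t + \<beta> t * \<beta> t) has_vector_derivative 0) (at t within {0..1})"
      by (rule has_vector_derivative_transform [OF t _ has_vector_derivative_const [of 1]])
         (use rot(3) in auto)
    have "(\<alpha>' t * \<alpha> t + \<alpha>' t * \<alpha> t) + (\<beta>' t * \<beta> t + \<beta>' t * \<beta> t) = 0"
      using vector_derivative_within_closed_interval [OF zero_less_one t d1]
        vector_derivative_within_closed_interval [OF zero_less_one t d2] by simp
    then have o: "\<alpha>' t * \<alpha> t + \<beta>' t * \<beta> t = 0" by simp
    have "\<alpha>' t = - \<beta> t * \<omega> t" "\<beta>' t = \<alpha> t * \<omega> t"
      using o rot(3) [OF t] unfolding \<omega>_def by algebra+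
    then show ?thesis by simp
  qed
  define \<phi> where "\<phi> = (\<lambda>t. fst v0 / sqrt k + integral {0..t} \<omega>)"
  have c\<omega>: "continuous_on {0..1} \<omega>" unfolding \<omega>_def by (intro continuous_intros)
  have d\<phi>: "(\<phi> has_real_derivative \<omega> t) (at t within {0..1})" if "t \<in> {0..1}" for t
    unfolding \<phi>_def has_real_derivative_iff_has_vector_derivative
    using integral_has_vector_derivative [OF c\<omega> that] by (auto intro!: derivative_eq_intros)
  note d\<phi> [derivative_intros]
  have \<phi>0: "\<phi> 0 = fst v0 / sqrt k" by (simp add: \<phi>_def)
  have init: "\<alpha> 0 = cos (\<phi> 0)" "\<beta> 0 = sin (\<phi> 0)" "x 0 = exp (fst (snd v0))" "y 0 = exp (snd (snd v0))"
    by (simp_all add: \<alpha>_def \<beta>_def x_def y_def \<gamma>0 \<phi>0, simp_all add: chart_def)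
  \<comment> \<open>The first column of the rotation factor, turned back by \<open>\<phi>\<close>.\<close>
  define C S where "C = (\<lambda>t. \<alpha> t * cos (\<phi> t) + \<beta> t * sin (\<phi> t))" 
    and "S = (\<lambda>t. \<beta> t * cos (\<phi> t) - \<alpha> t * sin (\<phi> t))"
  have "(C has_real_derivative 0) (at t within {0..1})" if "t \<in> {0..1}" for t
    unfolding C_def using that tangent [OF that]
    by (auto intro!: derivative_eq_intros simp: algebra_simps)
  then obtain c1 where c1: "\<And>t. t \<in> {0..1} \<Longrightarrow> C t = c1"
    using has_field_derivative_zero_constant [of "{0..1}" C] by auto
  have "(S has_real_derivative 0) (at t within {0..1})" if "t \<in> {0..1}" for t
    unfolding S_def using that tangent [OF that]
    by (auto intro!: derivative_eq_intros simp: algebra_simps)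
  then obtain c2 where c2: "\<And>t. t \<in> {0..1} \<Longrightarrow> S t = c2"
    using has_field_derivative_zero_constant [of "{0..1}" S] by auto
  have CS: "C t = 1" "S t = 0" if "t \<in> {0..1}" for t
    using c1 [OF that] c1 [of 0] c2 [OF that] c2 [of 0]
    by (auto simp: C_def S_def init simp flip: power2_eq_square)
  have angle: "\<alpha> t = cos (\<phi> t) \<and> \<beta> t = sin (\<phi> t)" if "t \<in> {0..1}" for t
  proof -
    have "\<alpha> t * ((sin (\<phi> t))\<^sup>2 + (cos (\<phi> t))\<^sup>2) = cos (\<phi> t) * C t - sin (\<phi> t) * S t"
      and "\<beta> t * ((sin (\<phi> t))\<^sup>2 + (cos (\<phi> t))\<^sup>2) = sin (\<phi> t) * C t + cos (\<phi> t) * S t"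
      unfolding C_def S_def power2_eq_square by (simp_all only: algebra_simps)
    then show ?thesis unfolding sin_cos_squared_add CS [OF that] by simp
  qed
  define v where "v = (\<lambda>t. (sqrt k * \<phi> t, ln (x t), ln (y t)))"
  define v' where "v' = (\<lambda>t. (sqrt k * \<omega> t, x' t / x t, y' t / y t))"
  show ?thesis
  proof (rule that [of v v'])
    show "v 0 = v0" using k by (simp add: v_def init \<phi>0)
    show "\<gamma> t = chart k (v t)" if t: "t \<in> {0..1}" for t
      using rot [OF t] angle [OF t] k
      by (simp add: chart_def v_def prod_eq_iff matrix2_eq_iff \<alpha>_def \<beta>_def x_def y_def)
    show "(v has_vector_derivative v' t) (at t within {0..1})" if t: "t \<in> {0..1}" for t
      unfolding v_def v'_def
      by (intro has_vector_derivative_Pair; unfold has_real_derivative_iff_has_vector_derivative [symmetric])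
        (use t rot [OF t] in \<open>auto intro!: derivative_eq_intros\<close>)
    show "continuous_on {0..1} v'"
      unfolding v'_def using rot by (intro continuous_intros c\<omega>) (auto simp: less_le)
  qed
qed

section \<open>Shortest curves in Euclidean space\<close>

lemma displacement_le_length:
  fixes v :: "real \<Rightarrow> 'a::euclidean_space"
  assumes v: "\<And>t. t \<in> {0..1} \<Longrightarrow> (v has_vector_derivative v' t) (at t within {0..1})"
    and v': "continuous_on {0..1} v'" and rs: "0 \<le> r" "r \<le> s" "s \<le> 1"
  shows "norm (v s - v r) \<le> integral {r..s} (\<lambda>t. norm (v' t))"
proof -
  have sub: "{r..s} \<subseteq> {0..1}" using rs by auto
  have "(v' has_integral v s - v r) {r..s}"
    using rs sub by (intro fundamental_theorem_of_calculus has_vector_derivative_within_subset [OF v sub]) auto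
  moreover have "(\<lambda>t. norm (v' t)) integrable_on {r..s}"
    using continuous_on_subset [OF v' sub] by (intro integrable_continuous_real continuous_intros)
  ultimately show ?thesis
    using integral_norm_bound_integral [of v' "{r..s}" "\<lambda>t. norm (v' t)"] by (auto simp: has_integral_iff)
qed

text \<open>A curve no longer than the distance of its endpoints passes through each of its points with equality
  in the triangle inequality, so it runs inside a segment; constant speed fixes the parametrisation. The
  speed hypothesis is a local statement about distances, because a geodesic is only known to be locally
  minimising; differentiating it gives the norm of the velocity.\<close>

lemma straight_if_shortest_constant_speed:
  fixes v :: "real \<Rightarrow> 'a::euclidean_space"
  assumes v: "\<And>t. t \<in> {0..1} \<Longrightarrow> (v has_vector_derivative v' t) (at t within {0..1})"
    and v': "continuous_on {0..1} v'" 
    and speed: "\<And>t. t \<in> {0..1} \<Longrightarrow> eventually (\<lambda>s. norm (v s - v t) = c * \<bar>s - t\<bar>) (at t within {0..1})"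
    and short: "integral {0..1} (\<lambda>t. norm (v' t)) \<le> norm (v 1 - v 0)" and t: "t \<in> {0..1}"
  shows "v t = (1 - t) *\<^sub>R v 0 + t *\<^sub>R v 1"
proof -
  have c: "norm (v' t) = c" if t: "t \<in> {0..1}" for t
  proof -
    have nt: "at t within {0..1} \<noteq> bot"
      using t by (simp add: islimpt_Icc trivial_limit_within)
    have "((\<lambda>s. norm ((v s - v t) /\<^sub>R (s - t))) \<longlongrightarrow> norm (v' t)) (at t within {0..1})"
    proof (rule tendsto_norm)
      have "((\<lambda>s. norm ((v s - v t - (s - t) *\<^sub>R v' t) /\<^sub>R \<bar>s - t\<bar>)) \<longlongrightarrow> 0) (at t within {0..1})"
        using v [OF t] unfolding has_vector_derivative_def has_derivative_at_within
        by (intro tendsto_norm_zero) auto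
      moreover have "eventually (\<lambda>s. s \<noteq> t) (at t within {0..1})"
        by (simp add: eventually_at_filter)
      then have "eventually (\<lambda>s. norm ((v s - v t - (s - t) *\<^sub>R v' t) /\<^sub>R \<bar>s - t\<bar>)
          = norm ((v s - v t) /\<^sub>R (s - t) - v' t)) (at t within {0..1})"
      proof eventually_elim
        case (elim s)
        then have "(v s - v t) /\<^sub>R (s - t) - v' t = (v s - v t - (s - t) *\<^sub>R v' t) /\<^sub>R (s - t)"
          by (simp add: scaleR_diff_right)
        then show ?case by simp
      qed
      ultimately have "((\<lambda>s. norm ((v s - v t) /\<^sub>R (s - t) - v' t)) \<longlongrightarrow> 0) (at t within {0..1})"
        by (rule Lim_transform_eventually)
      then show "((\<lambda>s. (v s - v t) /\<^sub>R (s - t)) \<longlongrightarrow> v' t) (at t within {0..1})"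
        by (rule LIM_zero_cancel [OF tendsto_norm_zero_cancel])
    qed
    moreover have "((\<lambda>s. norm ((v s - v t) /\<^sub>R (s - t))) \<longlongrightarrow> c) (at t within {0..1})"
    proof (rule tendsto_eventually)
      have "eventually (\<lambda>s. s \<noteq> t) (at t within {0..1})"
        by (simp add: eventually_at_filter)
      with speed [OF t] show "eventually (\<lambda>s. norm ((v s - v t) /\<^sub>R (s - t)) = c) (at t within {0..1})"
        by eventually_elim auto
    qed
    ultimately show ?thesis using tendsto_unique [OF nt] by blast
  qed
  have len: "integral {r..s} (\<lambda>t. norm (v' t)) = c * (s - r)" if "0 \<le> r" "r \<le> s" "s \<le> 1" for r s
  proof -
    have "integral {r..s} (\<lambda>t. norm (v' t)) = integral {r..s} (\<lambda>t. c)"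
      by (rule integral_cong) (use that c in auto)
    then show ?thesis using that by simp
  qed
  have 1: "norm (v t - v 0) \<le> c * t" and 2: "norm (v 1 - v t) \<le> c * (1 - t)" and 3: "c \<le> norm (v 1 - v 0)"
    using displacement_le_length [OF v v', of 0 t] displacement_le_length [OF v v', of t 1]
      short t by (auto simp: len)
  have 4: "norm (v 1 - v 0) \<le> norm (v 1 - v t) + norm (v t - v 0)" 
    using norm_triangle_ineq [of "v 1 - v t" "v t - v 0"] by simp
  have n: "norm (v t - v 0) = c * t" "norm (v 1 - v t) = c * (1 - t)" "norm (v 1 - v 0) = c"
    using 1 2 3 4 by (auto simp: algebra_simps)
  have "dist (v 1) (v 0) = dist (v 1) (v t) + dist (v t) (v 0)"
    by (simp add: dist_norm n algebra_simps)
  then have "(c * (1 - t)) *\<^sub>R (v t - v 0) = (c * t) *\<^sub>R (v 1 - v t)"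
    by (simp add: dist_triangle_eq n)
  then have "c *\<^sub>R (v t - ((1 - t) *\<^sub>R v 0 + t *\<^sub>R v 1)) = 0"
    by (simp add: algebra_simps)
  then have "c = 0 \<or> v t = (1 - t) *\<^sub>R v 0 + t *\<^sub>R v 1" by simp
  moreover have "v t = v 0" "v 1 = v 0" if "c = 0" using n that by auto
  ultimately show ?thesis by (auto simp: algebra_simps)
qed

section \<open>Distances and geodesics\<close>

lemma chart_segment:
  assumes k: "k > 0"
  defines "\<gamma> \<equiv> \<lambda>v w t. chart k ((1 - t) *\<^sub>R v + t *\<^sub>R w)"
  shows "C1_curveM (\<gamma> v w)" and "curve_lengthM k (\<gamma> v w) = norm (v - w)"
proof -
  have d: "((\<lambda>t. (1 - t) *\<^sub>R v + t *\<^sub>R w) has_vector_derivative w - v) (at t within {0..1})" for t :: real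
    by (auto intro!: derivative_eq_intros)
  show "C1_curveM (\<gamma> v w)" "curve_lengthM k (\<gamma> v w) = norm (v - w)"
    using curve_via_chart [OF k _ d, of "\<gamma> v w"] by (auto simp: \<gamma>_def norm_minus_commute)
qed

lemma curve_length_ge:
  assumes k: "k > 0" and "C1_curveM \<gamma>" "\<gamma> 0 = chart k v"
  obtains w where "chart k w = \<gamma> 1" "norm (v - w) \<le> curve_lengthM k \<gamma>"
proof -
  obtain u u' where u: "u 0 = v" "\<And>t. t \<in> {0..1} \<Longrightarrow> \<gamma> t = chart k (u t)"
    "\<And>t. t \<in> {0..1} \<Longrightarrow> (u has_vector_derivative u' t) (at t within {0..1})"
    "continuous_on {0..1} u'"
    using C1_curve_lift assms by metis
  have "norm (u 1 - u 0) \<le> integral {0..1} (\<lambda>t. norm (u' t))"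
    by (rule displacement_le_length [OF u(3,4)]) auto
  also have "\<dots> = curve_lengthM k \<gamma>"
    using curve_via_chart [OF k u(2,3,4)] by simp
  finally show ?thesis
    using u(1) u(2) [of 1] that [of "u 1"] by (simp add: norm_minus_commute)
qed

lemma distM_le_length:
  fixes \<gamma> :: "real \<Rightarrow> 2 eigpair"
  assumes k: "k > 0" and \<gamma>: "C1_curveM \<gamma>"
  shows "distM k (\<gamma> 0) (\<gamma> 1) \<le> curve_lengthM k \<gamma>"
  unfolding distM_def
proof (rule cInf_lower)
  show "bdd_below {curve_lengthM k \<delta> |\<delta>. C1_curveM \<delta> \<and> \<delta> 0 = \<gamma> 0 \<and> \<delta> 1 = \<gamma> 1}"
  proof (rule bdd_belowI [of _ 0], safe)
    fix \<delta> :: "real \<Rightarrow> 2 eigpair" assume \<delta>: "C1_curveM \<delta>"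
    then have "\<delta> 0 \<in> eigM" by (auto simp: C1_curveM_def)
    then obtain v where "\<delta> 0 = chart k v" using eigM_chartE [OF k] by metis
    then obtain w where "norm (v - w) \<le> curve_lengthM k \<delta>" using curve_length_ge [OF k \<delta>] by metis
    then show "0 \<le> curve_lengthM k \<delta>" using norm_ge_zero order_trans by blast
  qed
qed (use \<gamma> in auto)

lemma distM_chart_le:
  assumes "k > 0"
  shows "distM k (chart k v) (chart k w) \<le> norm (v - w)"
  using distM_le_length [OF assms chart_segment(1) [OF assms, of v w]] chart_segment(2) [OF assms, of v w]
  by simp

text \<open>The distance is the least distance between lifts; the lift of one endpoint may be kept fixed, since
  every curve can be lifted from there.\<close>

lemma distM_chart_ge:
  assumes k: "k > 0" and \<delta>: "\<And>w'. chart k w' = chart k w \<Longrightarrow> \<delta> \<le> norm (v - w')"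
  shows "\<delta> \<le> distM k (chart k v) (chart k w)"
  unfolding distM_def
proof (rule cInf_greatest)
  show "{curve_lengthM k \<gamma> |\<gamma>. C1_curveM \<gamma> \<and> \<gamma> 0 = chart k v \<and> \<gamma> 1 = chart k w} \<noteq> {}"
  proof -
    have "curve_lengthM k (\<lambda>t. chart k ((1 - t) *\<^sub>R v + t *\<^sub>R w))
        \<in> {curve_lengthM k \<gamma> |\<gamma>. C1_curveM \<gamma> \<and> \<gamma> 0 = chart k v \<and> \<gamma> 1 = chart k w}"
      by (intro CollectI exI conjI, rule refl, rule chart_segment(1) [OF k]) auto
    then show ?thesis by blast
  qed
next
  fix l assume "l \<in> {curve_lengthM k \<gamma> |\<gamma>. C1_curveM \<gamma> \<and> \<gamma> 0 = chart k v \<and> \<gamma> 1 = chart k w}"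
  then obtain \<gamma> where \<gamma>: "C1_curveM \<gamma>" "\<gamma> 0 = chart k v" "\<gamma> 1 = chart k w" "l = curve_lengthM k \<gamma>"
    by blast
  then obtain w' where "chart k w' = \<gamma> 1" "norm (v - w') \<le> l"
    using curve_length_ge [OF k] by metis
  then show "\<delta> \<le> l" using \<delta> [of w'] \<gamma>(3) by simp
qed

lemma norm_prod3_mono:
  fixes v w :: "real \<times> real \<times> real"
  assumes "\<bar>fst v\<bar> \<le> \<bar>fst w\<bar>" "snd v = snd w"
  shows "norm v \<le> norm w"
proof -
  have "(norm v)\<^sup>2 \<le> (norm w)\<^sup>2"
    unfolding norm_prod3 using assms by (simp add: abs_le_square_iff)
  then show ?thesis by (rule power2_le_imp_le) simp
qed

text \<open>If the angles differ by at most half a turn, no other lift of the endpoint is closer.\<close>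

lemma distM_chart:
  assumes k: "k > 0" and near: "\<bar>fst v - fst w\<bar> \<le> sqrt k * pi"
  shows "distM k (chart k v) (chart k w) = norm (v - w)"
proof (rule antisym)
  show "norm (v - w) \<le> distM k (chart k v) (chart k w)"
  proof (rule distM_chart_ge [OF k])
    fix w' assume "chart k w' = chart k w"
    then obtain n :: int where n: "fst w' = fst w + sqrt k * (2 * pi * n)" and s: "snd w' = snd w"
      using chart_eq_iff [OF k] by blast
    show "norm (v - w) \<le> norm (v - w')"
    proof (cases "n = 0")
      case True
      then have "w' = w" using n s by (intro prod_eqI) auto
      then show ?thesis by simp
    next
      case False
      then have "\<bar>real_of_int n\<bar> \<ge> 1" by linarith
      then have "sqrt k * pi * (2 * 1) \<le> sqrt k * pi * (2 * \<bar>real_of_int n\<bar>)"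
        using k by (intro mult_left_mono) auto
      also have "\<dots> = \<bar>fst w' - fst w\<bar>"
        using k n by (simp add: abs_mult)
      finally have "\<bar>fst v - fst w\<bar> \<le> \<bar>fst v - fst w'\<bar>" using near by linarith
      then show ?thesis using s by (intro norm_prod3_mono) auto
    qed
  qed
qed (rule distM_chart_le [OF k])

lemma geodesicM_chart_segment:
  assumes k: "k > 0"
  shows "geodesicM k (\<lambda>t. chart k ((1 - t) *\<^sub>R v + t *\<^sub>R w))"
proof -
  \<comment> \<open>Parameters within distance \<open>2 * e\<close> of each other give points whose angles differ by at most half a turn.\<close>
  define B where "B = \<bar>fst w - fst v\<bar> + 1"
  define e where "e = sqrt k * pi / (2 * B)"
  have B: "B > 0" by (simp add: B_def)
  have e: "e > 0" using k B by (simp add: e_def)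
  have "distM k (chart k ((1 - r) *\<^sub>R v + r *\<^sub>R w)) (chart k ((1 - s) *\<^sub>R v + s *\<^sub>R w)) = norm (w - v) * \<bar>r - s\<bar>"
    if "r \<in> ball t e" "s \<in> ball t e" for r s t
  proof -
    have eq: "((1 - r) *\<^sub>R v + r *\<^sub>R w) - ((1 - s) *\<^sub>R v + s *\<^sub>R w) = (r - s) *\<^sub>R (w - v)"
      by (simp add: algebra_simps)
    have rs: "\<bar>r - s\<bar> \<le> 2 * e" using that by (simp add: dist_real_def)
    have "fst ((1 - r) *\<^sub>R v + r *\<^sub>R w) - fst ((1 - s) *\<^sub>R v + s *\<^sub>R w) = (r - s) * (fst w - fst v)"
      using arg_cong [OF eq, of fst] by simp
    then have "\<bar>fst ((1 - r) *\<^sub>R v + r *\<^sub>R w) - fst ((1 - s) *\<^sub>R v + s *\<^sub>R w)\<bar> = \<bar>r - s\<bar> * \<bar>fst w - fst v\<bar>"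
      by (simp add: abs_mult)
    also have "\<dots> \<le> (2 * e) * B"
      using rs by (intro mult_mono) (auto simp: B_def)
    also have "\<dots> = sqrt k * pi"
      using B by (simp add: e_def)
    finally show ?thesis
      using distM_chart [OF k] by (simp add: eq mult.commute)
  qed
  then show ?thesis
    unfolding geodesicM_def using e chart_segment(1) [OF k, of v w] by blast
qed

section \<open>Minimal geodesics between fibres\<close>

lemma minimal_geodesic_chart_segment:
  assumes "k > 0" and "chart k v \<in> fiber X" "chart k w \<in> fiber Y" "dist_SR k X Y = norm (v - w)"
  shows "minimal_geodesic k X Y (\<lambda>t. chart k ((1 - t) *\<^sub>R v + t *\<^sub>R w))"
  using assms by (simp add: minimal_geodesic_def geodesicM_chart_segment chart_segment)

text \<open>The lift of the geodesic has length \<open>dist_SR k X Y\<close>, and its endpoints are at least that far apart,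
  by the hypothesis on lifts of points of \<open>fiber Y\<close>. So the lift is a shortest curve; by continuity, nearby
  points of it have angles within half a turn, where the distance on the manifold agrees with that of the
  lifts, and the local condition on the geodesic passes to its lift.\<close>

lemma minimal_geodesic_is_chart_segment:
  assumes k: "k > 0" and min: "minimal_geodesic k X Y \<gamma>" and \<gamma>0: "\<gamma> 0 = chart k v"
    and dist: "\<And>w. chart k w \<in> fiber Y \<Longrightarrow> dist_SR k X Y \<le> norm (v - w)"
  shows "\<exists>w. chart k w = \<gamma> 1 \<and> norm (v - w) = dist_SR k X Y \<and>
    (\<forall>t\<in>{0..1}. \<gamma> t = chart k ((1 - t) *\<^sub>R v + t *\<^sub>R w))"
proof -
  have geo: "geodesicM k \<gamma>" and \<gamma>1: "\<gamma> 1 \<in> fiber Y" and len: "curve_lengthM k \<gamma> = dist_SR k X Y"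
    using min by (auto simp: minimal_geodesic_def)
  obtain u u' where u: "u 0 = v" "\<And>t. t \<in> {0..1} \<Longrightarrow> \<gamma> t = chart k (u t)"
    and d: "\<And>t. t \<in> {0..1} \<Longrightarrow> (u has_vector_derivative u' t) (at t within {0..1})"
    and c: "continuous_on {0..1} u'"
    using C1_curve_lift k \<gamma>0 geo [unfolded geodesicM_def] by metis
  have L: "integral {0..1} (\<lambda>t. norm (u' t)) = dist_SR k X Y"
    using curve_via_chart [OF k u(2) d c] len by simp
  have "norm (u 1 - u 0) \<le> integral {0..1} (\<lambda>t. norm (u' t))"
    by (rule displacement_le_length [OF d c]) auto
  moreover have ge: "dist_SR k X Y \<le> norm (u 1 - u 0)"
    using dist [of "u 1"] \<gamma>1 u by (simp add: norm_minus_commute)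
  ultimately have n: "norm (v - u 1) = dist_SR k X Y"
    using L u(1) by (simp add: norm_minus_commute)
  obtain c where local: "\<And>t. t \<in> {0..1} \<Longrightarrow> \<exists>e>0. \<forall>r\<in>{0..1} \<inter> ball t e. \<forall>s\<in>{0..1} \<inter> ball t e.
        distM k (\<gamma> r) (\<gamma> s) = c * \<bar>r - s\<bar>"
    using geo unfolding geodesicM_def by blast
  have cu: "continuous_on {0..1} u"
    using d by (rule continuous_on_vector_derivative)
  have speed: "eventually (\<lambda>s. norm (u s - u t) = c * \<bar>s - t\<bar>) (at t within {0..1})"
    if t: "t \<in> {0..1}" for t
  proof -
    obtain e where e: "e > 0" "\<And>r s. r \<in> {0..1} \<inter> ball t e \<Longrightarrow> s\<in>{0..1} \<inter> ball t e \<Longrightarrow>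
        distM k (\<gamma> r) (\<gamma> s) = c * \<bar>r - s\<bar>"
      using local [OF t] by blast
    have "eventually (\<lambda>s. s \<in> {0..1} \<and> dist s t < e) (at t within {0..1})"
      using e(1) by (auto simp: eventually_at)
    moreover have "((\<lambda>s. fst (u s)) \<longlongrightarrow> fst (u t)) (at t within {0..1})"
      using cu t by (intro tendsto_fst) (auto simp: continuous_on)
    then have "eventually (\<lambda>s. dist (fst (u s)) (fst (u t)) < sqrt k * pi) (at t within {0..1})"
      using k by (intro tendstoD) auto
    ultimately show ?thesis
    proof eventually_elim
      case (elim s)
      then have "distM k (\<gamma> s) (\<gamma> t) = c * \<bar>s - t\<bar>"
        using e t by (auto simp: dist_commute)
      moreover have "distM k (\<gamma> s) (\<gamma> t) = norm (u s - u t)"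
        using elim t distM_chart [OF k, of "u s" "u t"] by (simp add: u dist_real_def)
      ultimately show ?case by simp
    qed
  qed
  have line: "u t = (1 - t) *\<^sub>R u 0 + t *\<^sub>R u 1" if "t \<in> {0..1}" for t
    by (rule straight_if_shortest_constant_speed [OF d \<open>continuous_on {0..1} u'\<close> speed _ that]) (use L ge in auto)
  show ?thesis
  proof (intro exI [of _ "u 1"] conjI ballI n)
    show "chart k (u 1) = \<gamma> 1" using u(2) [of 1] by simp
  next
    fix t :: real assume t: "t \<in> {0..1}"
    show "\<gamma> t = chart k ((1 - t) *\<^sub>R v + t *\<^sub>R u 1)"
      unfolding u(2) [OF t] u(1) [symmetric] line [OF t, symmetric] ..
  qed
qed

lemma dist_SR_eq_chart:
  assumes k: "k > 0" and vw: "chart k v \<in> fiber X" "chart k w \<in> fiber Y"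
    and least: "\<And>v' w'. chart k v' \<in> fiber X \<Longrightarrow> chart k w' \<in> fiber Y \<Longrightarrow> norm (v - w) \<le> norm (v' - w')"
  shows "dist_SR k X Y = norm (v - w)" and "distM k (chart k v) (chart k w) = norm (v - w)"
proof -
  have ge: "norm (v - w) \<le> distM k p q" if p: "p \<in> fiber X" and q: "q \<in> fiber Y" for p q
  proof -
    obtain v' w' where "p = chart k v'" "q = chart k w'"
      using p q eigM_chartE [OF k] by (metis (no_types, lifting) fiber_def mem_Collect_eq)
    then show ?thesis
      using p q by (auto intro!: distM_chart_ge [OF k] least)
  qed
  show *: "distM k (chart k v) (chart k w) = norm (v - w)"
    using ge [OF vw] distM_chart_le [OF k, of v w] by simp
  show "dist_SR k X Y = norm (v - w)"
    unfolding dist_SR_def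
  proof (rule cInf_eq_minimum)
    show "norm (v - w) \<in> {distM k p q |p q. p \<in> fiber X \<and> q \<in> fiber Y}"
      using vw unfolding * [symmetric] by blast
  qed (use ge in blast)
qed

section \<open>Quarter turns and the fibres\<close>

text \<open>Rotating the frame by \<open>n * \<pi>/2\<close> and permuting the eigenvalues accordingly, expressed on lifts.\<close>

definition turn :: "real \<Rightarrow> int \<Rightarrow> real \<times> real \<times> real \<Rightarrow> real \<times> real \<times> real" where
  "turn k n v = (fst v + sqrt k * (n * pi / 2), if even n then snd v else prod.swap (snd v))"

lemma turn_turn: "turn k m (turn k n v) = turn k (m + n) v"
  by (cases v) (auto simp: turn_def algebra_simps add_divide_distrib)

lemma turn_0 [simp]: "turn k 0 v = v"
  by (simp add: turn_def)

lemma norm_turn_diff: "norm (turn k n v - turn k n w) = norm (v - w)"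
proof -
  have "(norm (turn k n v - turn k n w))\<^sup>2 = (norm (v - w))\<^sup>2"
    unfolding norm_prod3 by (auto simp: turn_def)
  then show ?thesis by simp
qed

lemma norm_turn_turn: "norm (turn k m v - turn k n w) = norm (v - turn k (n - m) w)"
  using norm_turn_diff [of k m v "turn k (n - m) w"] by (simp add: turn_turn)

lemma turn_segment:
  "turn k n ((1 - t) *\<^sub>R v + t *\<^sub>R w) = (1 - t) *\<^sub>R turn k n v + t *\<^sub>R turn k n w"
proof -
  have "(1 - t) * x + t * x = x" for x :: real by (simp add: algebra_simps)
  from this [of "sqrt k * (n * pi / 2)"] show ?thesis
    by (simp add: turn_def prod_eq_iff distrib_left)
qed

lemma eigF_chart:
  "eigF (chart k v) = symm2 ((exp (fst (snd v)) + exp (snd (snd v))) / 2) 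
     ((exp (fst (snd v)) - exp (snd (snd v))) / 2) (2 * (fst v / sqrt k))"
  by (simp add: eigF_def chart_def Rot_conj_diag2)

lemma exp_sum_diff_eq_iff:
  fixes x y x' y' :: real
  shows "(exp x + exp y) / 2 = (exp x' + exp y') / 2 \<and> (exp x' - exp y') / 2 = (exp x - exp y) / 2
     \<longleftrightarrow> x' = x \<and> y' = y"
proof -
  have "exp x' = exp x \<and> exp y' = exp y" 
    if "(exp x + exp y) / 2 = (exp x' + exp y') / 2" "(exp x' - exp y') / 2 = (exp x - exp y) / 2"
    using that by argo
  then show ?thesis by auto
qed

text \<open>In terms of \<open>symm2\<close>, a change of sign of the radius corresponds to swapping the eigenvalues and to
  adding \<open>\<pi>\<close> to the doubled angle, that is, to an odd number of quarter turns.\<close>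

lemma eigF_chart_eq_iff:
  assumes k: "k > 0" and v: "fst (snd v) \<noteq> snd (snd v)"
  shows "eigF (chart k w) = eigF (chart k v) \<longleftrightarrow> (\<exists>n. w = turn k n v)"
proof -
  obtain p x y q x' y' where vw: "v = (p, x, y)" "w = (q, x', y')" by (metis prod.exhaust)
  have "eigF (chart k w) = eigF (chart k v) \<longleftrightarrow>
    (x', y') = (x, y) \<and> (\<exists>n::int. 2 * (q / sqrt k) = 2 * (p / sqrt k) + 2 * pi * n) \<or>
    (x', y') = (y, x) \<and> (\<exists>n::int. 2 * (q / sqrt k) = 2 * (p / sqrt k) + pi + 2 * pi * n)"
    proof -
    have neg: "- ((exp x - exp y) / 2) = (exp y - exp x) / 2" by argo
    have ne: "(exp x - exp y) / 2 \<noteq> 0" using v by (simp add: vw)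
    have "symm2 ((exp x' + exp y') / 2) ((exp x' - exp y') / 2) \<beta> =
        symm2 ((exp x + exp y) / 2) ((exp x - exp y) / 2) \<alpha> \<longleftrightarrow>
        (x', y') = (x, y) \<and> (\<exists>n::int. \<beta> = \<alpha> + 2 * pi * n) \<or>
        (x', y') = (y, x) \<and> (\<exists>n::int. \<beta> = \<alpha> + pi + 2 * pi * n)" for \<alpha> \<beta>
      unfolding eq_commute [of "symm2 _ _ \<beta>"] symm2_eq_iff [OF ne] neg prod.inject
        exp_sum_diff_eq_iff [of x y x' y', symmetric] exp_sum_diff_eq_iff [of y x x' y', symmetric]
        add.commute [of "exp y" "exp x"] by blast
    then show ?thesis unfolding eigF_chart vw fst_conv snd_conv .
  qed
  also have "(\<lambda>n::int. 2 * (q / sqrt k) = 2 * (p / sqrt k) + 2 * pi * n) = 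
      (\<lambda>n. q = p + sqrt k * (of_int (2 * n) * pi / 2))"
    using k by (auto simp: fun_eq_iff field_simps)
  also have "(\<lambda>n::int. 2 * (q / sqrt k) = 2 * (p / sqrt k) + pi + 2 * pi * n) = 
      (\<lambda>n. q = p + sqrt k * (of_int (2 * n + 1) * pi / 2))"
    using k by (auto simp: fun_eq_iff field_simps)
  also have "(x', y') = (x, y) \<and> (\<exists>n. q = p + sqrt k * (of_int (2 * n) * pi / 2)) \<or>
    (x', y') = (y, x) \<and> (\<exists>n. q = p + sqrt k * (of_int (2 * n + 1) * pi / 2)) \<longleftrightarrow> 
    (\<exists>n. w = turn k (2 * n) v) \<or> (\<exists>n. w = turn k (2 * n + 1) v)"
    unfolding vw turn_def by (simp add: conj_commute)
  also have "\<dots> \<longleftrightarrow> (\<exists>n. w = turn k n v)" by (metis evenE oddE)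
  finally show ?thesis .
qed

lemma eigF_chart_turn: "k > 0 \<Longrightarrow> eigF (chart k (turn k n v)) = eigF (chart k v)"
proof (cases "fst (snd v) = snd (snd v)")
  case True
  then show ?thesis by (simp add: eigF_chart turn_def matrix2)
next
  case False
  then show "k > 0 \<Longrightarrow> ?thesis" using eigF_chart_eq_iff by blast
qed

lemma fiber_eigF_chart:
  assumes "k > 0" "fst (snd v) \<noteq> snd (snd v)"
  shows "chart k w \<in> fiber (eigF (chart k v)) \<longleftrightarrow> (\<exists>n. w = turn k n v)"
  using assms by (simp add: fiber_def chart_in_eigM eigF_chart_eq_iff)

text \<open>Turning moves a pair within its fibre, and four quarter turns return to it; as the eigenvalues are
  distinct, these four pairs are all different.\<close>

lemma chart_turn_eq_iff:
  assumes k: "k > 0" and v: "fst (snd v) \<noteq> snd (snd v)"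
  shows "chart k (turn k m v) = chart k (turn k n v) \<longleftrightarrow> 4 dvd m - n"
proof -
  have "snd (turn k m v) = snd (turn k n v) \<longleftrightarrow> even (m - n)"
    using v by (cases v) (auto simp: turn_def)
  moreover have "fst (turn k m v) = fst (turn k n v) + sqrt k * (2 * pi * j) \<longleftrightarrow> m - n = 4 * j" for j :: int
  proof -
    have "fst (turn k m v) - (fst (turn k n v) + sqrt k * (2 * pi * j)) = sqrt k * pi / 2 * (real_of_int (m - n - 4 * j))"
      by (simp add: turn_def field_simps)
    moreover have "sqrt k * pi / 2 \<noteq> 0" using k by simp
    ultimately have "fst (turn k m v) = fst (turn k n v) + sqrt k * (2 * pi * j) \<longleftrightarrow> m - n - 4 * j = 0"
      by (metis eq_iff_diff_eq_0 mult_eq_0_iff of_int_eq_0_iff)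
    then show ?thesis by auto
  qed
  ultimately show ?thesis
    unfolding chart_eq_iff [OF k] by (auto simp: dvd_def)
qed

section \<open>Minimal scaling-rotation curves as segments\<close>

definition optimal :: "real \<Rightarrow> real \<times> real \<times> real \<Rightarrow> real \<times> real \<times> real \<Rightarrow> int set" where
  "optimal k v w = {n. \<forall>m. norm (v - turn k n w) \<le> norm (v - turn k m w)}"

definition joining :: "real \<Rightarrow> real \<times> real \<times> real \<Rightarrow> real \<times> real \<times> real \<Rightarrow> int \<Rightarrow> real \<Rightarrow> 2 eigpair" where
  "joining k v w n t = chart k ((1 - t) *\<^sub>R v + t *\<^sub>R turn k n w)"

context
  fixes k :: real and v w :: "real \<times> real \<times> real" and X Y :: "real^2^2"
  assumes k: "k > 0" and v: "fst (snd v) \<noteq> snd (snd v)" and w: "fst (snd w) \<noteq> snd (snd w)"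
    and X: "X = eigF (chart k v)" and Y: "Y = eigF (chart k w)"
begin

lemma optimal_dist_SR:
  assumes "n \<in> optimal k v w"
  shows "dist_SR k X Y = norm (v - turn k n w)" 
    and "distM k (chart k v) (chart k (turn k n w)) = norm (v - turn k n w)"
proof -
  have *: "chart k v \<in> fiber X" "chart k (turn k n w) \<in> fiber Y"
    by (auto simp: X Y fiber_def chart_in_eigM eigF_chart_turn k)
  have **: "norm (v - turn k n w) \<le> norm (v' - w')" if "chart k v' \<in> fiber X" "chart k w' \<in> fiber Y" for v' w'
    using that assms unfolding X Y fiber_eigF_chart [OF k v] fiber_eigF_chart [OF k w]
    by (auto simp: norm_turn_turn optimal_def)
  show "dist_SR k X Y = norm (v - turn k n w)" 
    "distM k (chart k v) (chart k (turn k n w)) = norm (v - turn k n w)"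
    using dist_SR_eq_chart [OF k * **] by auto
qed

lemma minimal_geodesic_joining: "n \<in> optimal k v w \<Longrightarrow> minimal_geodesic k X Y (joining k v w n)"
  unfolding joining_def
  by (rule minimal_geodesic_chart_segment [OF k])
     (auto simp: X Y fiber_def chart_in_eigM eigF_chart_turn k optimal_dist_SR [unfolded X Y])

text \<open>A minimal geodesic lifts to a segment from \<open>turn k i v\<close> to \<open>turn k l w\<close>; turning it back by \<open>i\<close> gives
  a segment from \<open>v\<close> to \<open>turn k (l - i) w\<close> with the same image in the symmetric matrices.\<close>

lemma minimal_geodesic_eq_joining:
  assumes n: "n \<in> optimal k v w" and min: "minimal_geodesic k X Y \<gamma>" 
  obtains i j where "j \<in> optimal k v w" "\<gamma> 0 = chart k (turn k i v)" "\<gamma> 1 = chart k (turn k (i + j) w)"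
    "\<And>t. t \<in> {0..1} \<Longrightarrow> eigF (\<gamma> t) = eigF (joining k v w j t)"
proof -
  have "\<gamma> 0 \<in> fiber X" using min by (simp add: minimal_geodesic_def)
  moreover then obtain v' where v': "\<gamma> 0 = chart k v'"
    using eigM_chartE [OF k] by (metis (no_types, lifting) fiber_def mem_Collect_eq)
  ultimately obtain i where i: "v' = turn k i v"
    using fiber_eigF_chart [OF k v] X by auto
  note dist = optimal_dist_SR(1) [OF n]
  have ge: "dist_SR k X Y \<le> norm (v' - w')" if "chart k w' \<in> fiber Y" for w'
    using that n unfolding Y fiber_eigF_chart [OF k w] dist [unfolded Y] i
    by (auto simp: norm_turn_turn optimal_def)
  obtain w' where w': "chart k w' = \<gamma> 1" "norm (v' - w') = dist_SR k X Y"
    "\<forall>t\<in>{0..1}. \<gamma> t = chart k ((1 - t) *\<^sub>R v' + t *\<^sub>R w')"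
    using minimal_geodesic_is_chart_segment [OF k min v' ge] by metis
  have "chart k w' \<in> fiber Y" using min w'(1) by (simp add: minimal_geodesic_def)
  then obtain l where l: "w' = turn k l w"
    using fiber_eigF_chart [OF k w] Y by auto
  show ?thesis
  proof (rule that [of "l - i" i])
    show "l - i \<in> optimal k v w" 
      using w'(2) n by (simp add: i l norm_turn_turn dist optimal_def)
    show "\<gamma> 0 = chart k (turn k i v)" "\<gamma> 1 = chart k (turn k (i + (l - i)) w)"
      using v' w'(1) i l by auto
    fix t :: real assume t: "t \<in> {0..1}"
    have "(1 - t) *\<^sub>R v' + t *\<^sub>R w' = turn k i ((1 - t) *\<^sub>R v + t *\<^sub>R turn k (l - i) w)"
      by (simp add: turn_segment turn_turn i l)
    then show "eigF (\<gamma> t) = eigF (joining k v w (l - i) t)"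
      using w'(3) t by (simp add: joining_def eigF_chart_turn k)
  qed
qed

lemma MSSR_curves_optimal:
  assumes n: "n \<in> optimal k v w"
  shows "MSSR_curves k X Y = (\<lambda>j. restrict (eigF \<circ> joining k v w j) {0..1}) ` optimal k v w"
proof (intro equalityI subsetI)
  fix \<xi> assume "\<xi> \<in> MSSR_curves k X Y"
  then obtain \<gamma> where \<xi>: "\<xi> = restrict (eigF \<circ> \<gamma>) {0..1}" and \<gamma>: "minimal_geodesic k X Y \<gamma>"
    by (auto simp: MSSR_curves_def)
  obtain i j where "j \<in> optimal k v w" "\<And>t. t \<in> {0..1} \<Longrightarrow> eigF (\<gamma> t) = eigF (joining k v w j t)"
    using minimal_geodesic_eq_joining [OF n \<gamma>] by metis
  then show "\<xi> \<in> (\<lambda>j. restrict (eigF \<circ> joining k v w j) {0..1}) ` optimal k v w"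
    unfolding \<xi> by (intro image_eqI [of _ _ j] restrict_ext) auto
qed (auto simp: MSSR_curves_def intro: minimal_geodesic_joining)

text \<open>The pair of endpoints on the manifold determines the number of turns only modulo 4. Uniqueness of the
  curve therefore requires that no other minimiser lies in the same residue class.\<close>

lemma MSSR_corresponds_optimal:
  assumes n: "n \<in> optimal k v w" and unique: "\<And>j. j \<in> optimal k v w \<Longrightarrow> 4 dvd j - n \<Longrightarrow> j = n"
  shows "MSSR_corresponds k X Y (chart k v) (chart k (turn k n w)) \<xi> \<longleftrightarrow>
     \<xi> = restrict (eigF \<circ> joining k v w n) {0..1}"
proof
  assume "MSSR_corresponds k X Y (chart k v) (chart k (turn k n w)) \<xi>"
  then obtain \<gamma> where \<xi>: "\<xi> = restrict (eigF \<circ> \<gamma>) {0..1}" and \<gamma>: "minimal_geodesic k X Y \<gamma>"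
    and ends: "\<gamma> 0 = chart k v" "\<gamma> 1 = chart k (turn k n w)"
    by (auto simp: MSSR_corresponds_def)
  obtain i j where j: "j \<in> optimal k v w" "\<gamma> 0 = chart k (turn k i v)" "\<gamma> 1 = chart k (turn k (i + j) w)"
    "\<And>t. t \<in> {0..1} \<Longrightarrow> eigF (\<gamma> t) = eigF (joining k v w j t)"
    using minimal_geodesic_eq_joining [OF n \<gamma>] by metis
  have "4 dvd i"
    using ends j chart_turn_eq_iff [OF k v, of i 0] by simp
  moreover have "4 dvd (i + j) - n"
    using ends j chart_turn_eq_iff [OF k w, of "i + j" n] by simp
  ultimately have "4 dvd ((i + j) - n) - i" by (rule dvd_diff [rotated])
  then have "j = n" using unique [OF j(1)] by (simp add: algebra_simps)
  then show "\<xi> = restrict (eigF \<circ> joining k v w n) {0..1}"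
    unfolding \<xi> using j(4) by (intro restrict_ext) auto
next
  assume "\<xi> = restrict (eigF \<circ> joining k v w n) {0..1}"
  then show "MSSR_corresponds k X Y (chart k v) (chart k (turn k n w)) \<xi>"
    unfolding MSSR_corresponds_def using minimal_geodesic_joining [OF n] by (auto simp: joining_def)
qed

end

section \<open>Spectral decomposition of pairs\<close>

text \<open>Polar coordinates of the traceless part give \<open>X = symm2 s h t\<close>. Two distinct eigenvalues exclude
  \<open>h = 0\<close>, and positivity of the form at the eigenvector of angle \<open>t/2 + \<pi>/2\<close> gives \<open>s - h > 0\<close>.\<close>

lemma SymPos_card_eigenvalues_2E:
  assumes X: "X \<in> SymPos" and card: "card (eigenvalues X) = 2"
  obtains t a b where "a > b" "X = Rot t ** diag2 (exp a) (exp b) ** transpose (Rot t)"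
proof -
  define s h where "s = (X$1$1 + X$2$2) / 2" and "h = sqrt (((X$1$1 - X$2$2) / 2)\<^sup>2 + (X$1$2)\<^sup>2)"
  have sym: "X$2$1 = X$1$2"
    using X transpose_nth [of X 1 2] by (simp add: SymPos_def)
  have "h \<noteq> 0"
  proof
    assume "h = 0"
    then have "X$1$1 = X$2$2" "X$1$2 = 0"
      by (auto simp: h_def real_sqrt_eq_0_iff sum_power2_eq_zero_iff)
    then have "X = X$1$1 *\<^sub>R mat 1"
      using sym by (simp add: matrix2)
    then have "X *v y = X$1$1 *\<^sub>R y" for y
      by (metis matrix_vector_mul_lid scaleR_matrix_vector_assoc)
    then have "eigenvalues X \<subseteq> {X$1$1}"
      by (auto simp: eigenvalues_def)
    then have "card (eigenvalues X) \<le> 1"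
      using card_mono [of "{X$1$1}"] by simp
    then show False using card by simp
  qed
  moreover have "h \<ge> 0" by (simp add: h_def)
  ultimately have h: "h > 0" by simp
  have "((X$1$1 - X$2$2) / 2 / h)\<^sup>2 + (X$1$2 / h)\<^sup>2 = (((X$1$1 - X$2$2) / 2)\<^sup>2 + (X$1$2)\<^sup>2) / h\<^sup>2"
    by (simp only: power_divide add_divide_distrib)
  also have "\<dots> = 1"
  proof -
    have "h\<^sup>2 = ((X$1$1 - X$2$2) / 2)\<^sup>2 + (X$1$2)\<^sup>2" by (simp add: h_def)
    then show ?thesis using h by (simp flip: \<open>h\<^sup>2 = _\<close>)
  qed
  finally obtain t where "(X$1$1 - X$2$2) / 2 / h = cos t" "X$1$2 / h = sin t"
    using sincos_total_2pi by metis
  then have "(X$1$1 - X$2$2) / 2 = h * cos t" "X$1$2 = h * sin t"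
    using h by (auto simp: field_simps)
  then have Xs: "X = symm2 s h t"
    using sym by (auto simp: matrix2 s_def field_simps)
  define S C where "S = sin (t/2)" and "C = cos (t/2)"
  define e :: "real^2" where "e = vector [- sin (t/2), cos (t/2)]"
  have "e \<noteq> 0"
    by (auto simp: e_def vec_eq_iff forall_2 dest: sin_zero_abs_cos_one)
  then have "e \<bullet> (X *v e) > 0"
    using X by (simp add: SymPos_def)
  also have "e \<bullet> (X *v e) = s * ((sin (t/2))\<^sup>2 + (cos (t/2))\<^sup>2) 
      - h * (cos t * ((cos (t/2))\<^sup>2 - (sin (t/2))\<^sup>2) + sin t * (2 * sin (t/2) * cos (t/2)))"
    unfolding Xs e_def C_def [symmetric] S_def [symmetric]
    by (simp add: inner_vec_def sum_2 matrix_vector_mult_def power2_eq_square algebra_simps)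
  also have "\<dots> = s - h * (cos t * cos t + sin t * sin t)"
    using cos_double [of "t/2"] sin_double [of "t/2"] unfolding sin_cos_squared_add by simp
  also have "\<dots> = s - h"
    by (simp flip: power2_eq_square)
  finally have "s - h > 0" .
  moreover have "X = Rot (t/2) ** diag2 (s + h) (s - h) ** transpose (Rot (t/2))"
    by (simp add: Rot_conj_diag2 Xs)
  ultimately show ?thesis
    using h that [of "ln (s - h)" "ln (s + h)" "t/2"] by simp
qed

text \<open>The matrix \<open>Y\<close> determines the angle of its frame only modulo \<open>\<pi>\<close>, so the relative angle can be
  taken in \<open>[0, \<pi>)\<close>.\<close>

lemma SymPos_pair_decomposition:
  assumes "X \<in> SymPos" "Y \<in> SymPos" "card (eigenvalues X) = 2" "card (eigenvalues Y) = 2"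
  shows "\<exists>a b c d \<theta>. \<exists>U \<in> SO. a > b \<and> c > d \<and> 0 \<le> \<theta> \<and> \<theta> < pi \<and>
               X = U ** diag2 (exp a) (exp b) ** transpose U \<and>
               Y = U ** Rot \<theta> ** diag2 (exp c) (exp d) ** transpose (Rot \<theta>) ** transpose U"
proof -
  obtain s a b where X: "a > b" "X = Rot s ** diag2 (exp a) (exp b) ** transpose (Rot s)"
    using SymPos_card_eigenvalues_2E assms by metis
  obtain t c d where Y: "c > d" "Y = Rot t ** diag2 (exp c) (exp d) ** transpose (Rot t)"
    using SymPos_card_eigenvalues_2E assms by metis
  define n where "n = \<lfloor>(t - s) / pi\<rfloor>"
  define \<theta> where "\<theta> = t - s - n * pi"
  have "of_int n \<le> (t - s) / pi" "(t - s) / pi < of_int n + 1"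
    unfolding n_def by linarith+
  then have \<theta>: "0 \<le> \<theta>" "\<theta> < pi"
    by (auto simp: \<theta>_def field_simps)
  have "sin (2 * (s + \<theta>)) = sin (2 * t) \<and> cos (2 * (s + \<theta>)) = cos (2 * t)"
    unfolding sin_cos_eq_iff by (intro exI [of _ "- n"]) (simp add: \<theta>_def algebra_simps)
  then have "Y = Rot (s + \<theta>) ** diag2 (exp c) (exp d) ** transpose (Rot (s + \<theta>))"
    unfolding Y Rot_conj_diag2 by (simp add: matrix2)
  also have "\<dots> = Rot s ** Rot \<theta> ** diag2 (exp c) (exp d) ** transpose (Rot \<theta>) ** transpose (Rot s)"
    by (simp add: Rot_add matrix_transpose_mul matrix_mul_assoc)
  finally show ?thesis
    using X Y(1) \<theta> SO_Rot by blast
qed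

section \<open>Comparison of the turns\<close>

definition sq_dist :: "real \<Rightarrow> real \<Rightarrow> real \<Rightarrow> real \<Rightarrow> real \<Rightarrow> real \<Rightarrow> int \<Rightarrow> real" where
  "sq_dist k a b c d \<theta> n = k * (\<theta> + n * pi / 2)\<^sup>2 + 
     (if even n then (a - c)\<^sup>2 + (b - d)\<^sup>2 else (a - d)\<^sup>2 + (b - c)\<^sup>2)"

lemma norm_diff_turn:
  assumes "k > 0"
  shows "(norm ((sqrt k * u, a, b) - turn k n (sqrt k * (u + \<theta>), c, d)))\<^sup>2 = sq_dist k a b c d \<theta> n"
proof -
  have "(sqrt k * u - (sqrt k * (u + \<theta>) + sqrt k * (n * pi / 2)))\<^sup>2 = (sqrt k * (\<theta> + n * pi / 2))\<^sup>2"
    by (simp add: power2_eq_iff algebra_simps)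
  also have "\<dots> = k * (\<theta> + n * pi / 2)\<^sup>2"
    using assms by (simp add: power_mult_distrib)
  finally show ?thesis
    unfolding norm_prod3 by (simp add: turn_def sq_dist_def)
qed

context
  fixes k a b c d \<theta> :: real
  assumes k: "k > 0" and ab: "a > b" and cd: "c > d" and \<theta>: "0 \<le> \<theta>" "\<theta> < pi"
begin

text \<open>Among the turns of one parity the eigenvalue term is constant, so \<open>n\<close> only has to be compared in
  angle with the nearest of \<open>0\<close>, \<open>-1\<close>, \<open>-2\<close> that has the same parity. The exception
  is \<open>\<theta> = 0\<close> with \<open>n\<close> odd: then \<open>1\<close> and \<open>-1\<close> have the same value, but pairing the eigenvalues in order is strictly better, so \<open>0\<close> wins.\<close>

lemma sq_dist_not_least:
  assumes n: "n \<notin> {0, -1, -2}"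
  shows "\<exists>m \<in> {0, -1, -2}. sq_dist k a b c d \<theta> m < sq_dist k a b c d \<theta> n"
proof -
  have less: "k * x\<^sup>2 < k * y\<^sup>2" if "\<bar>x\<bar> < \<bar>y\<bar>" for x y
    using that k by (metis abs_le_square_iff linorder_not_le mult_less_cancel_left_pos)
  have pos: "n * pi / 2 \<ge> pi / 2" if "n \<ge> 1" 
    using that by simp
  have neg: "n * pi / 2 \<le> - 3 * pi / 2" if "n \<le> -3"
  proof -
    have "real_of_int n \<le> -3" using that by linarith
    then show ?thesis using mult_right_mono [of "real_of_int n" "-3" pi] by simp
  qed
  have n3: "n \<ge> 1 \<or> n \<le> -3" using n by auto
  show ?thesis
  proof (cases "even n")
    case True
    from n3 show ?thesis
    proof
      assume "n \<ge> 1"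
      then have "\<bar>\<theta>\<bar> < \<bar>\<theta> + n * pi / 2\<bar>" 
        using pos \<theta> pi_gt_zero by linarith
      then show ?thesis using less True by (auto simp: sq_dist_def)
    next
      assume "n \<le> -3"
      then have "\<bar>\<theta> - pi\<bar> < \<bar>\<theta> + n * pi / 2\<bar>" 
        using neg \<theta> pi_gt_zero by linarith
      then show ?thesis using less True by (auto simp: sq_dist_def)
    qed
  next
    case False
    show ?thesis
    proof (cases "\<theta> = 0")
      case True
      have "(a - c)\<^sup>2 + (b - d)\<^sup>2 + 2 * ((a - b) * (c - d)) = (a - d)\<^sup>2 + (b - c)\<^sup>2"
        by (simp add: power2_eq_square algebra_simps)
      moreover have "(a - b) * (c - d) > 0" using ab cd by simp
      ultimately have "(a - c)\<^sup>2 + (b - d)\<^sup>2 < (a - d)\<^sup>2 + (b - c)\<^sup>2" by linarith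
      moreover have "k * (n * pi / 2)\<^sup>2 \<ge> 0" using k by simp
      ultimately show ?thesis using True False by (auto simp: sq_dist_def)
    next
      case t: False
      have "\<bar>\<theta> - pi / 2\<bar> < \<bar>\<theta> + n * pi / 2\<bar>" 
        using n3
      proof
        assume "n \<ge> 1"
        then show ?thesis using pos \<theta> t pi_gt_zero by linarith
      next
        assume "n \<le> -3"
        then show ?thesis using neg \<theta> t pi_gt_zero by linarith
      qed
      then show ?thesis using less False by (auto simp: sq_dist_def)
    qed
  qed
qed

lemma optimal_eq:
  fixes m I \<nu>
  assumes m: "m = 2 * (a - b) * (c - d) / (k * pi)"
    and I: "I = (if m > min \<theta> (pi - \<theta>) - pi / 4
                 then (if \<theta> < pi / 2 then {1} else if \<theta> = pi / 2 then {1, 2} else {2})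
                 else if m = min \<theta> (pi - \<theta>) - pi / 4
                 then (if \<theta> < pi / 2 then {1, 3} else if \<theta> = pi / 2 then {1, 2, 3} else {2, 3})
                 else {3 :: nat})"
    and \<nu>: "\<nu> 1 = 0" "\<nu> 2 = -2" "\<nu> 3 = -1"
  shows "optimal k (sqrt k * u, a, b) (sqrt k * (u + \<theta>), c, d) = \<nu> ` I"
proof -
  let ?f = "sq_dist k a b c d \<theta>"
  have norm: "norm ((sqrt k * u, a, b) - turn k i (sqrt k * (u + \<theta>), c, d)) 
      \<le> norm ((sqrt k * u, a, b) - turn k j (sqrt k * (u + \<theta>), c, d)) \<longleftrightarrow> ?f i \<le> ?f j" for i j
    using abs_le_square_iff [of "norm ((sqrt k * u, a, b) - turn k i (sqrt k * (u + \<theta>), c, d))"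
        "norm ((sqrt k * u, a, b) - turn k j (sqrt k * (u + \<theta>), c, d))"]
    unfolding norm_diff_turn [OF k] by simp
  have "optimal k (sqrt k * u, a, b) (sqrt k * (u + \<theta>), c, d) = {n. \<forall>j. ?f n \<le> ?f j}"
    by (simp only: optimal_def norm)
  also have "\<dots> = {n \<in> {0, -1, -2}. \<forall>j \<in> {0, -1, -2}. ?f n \<le> ?f j}"
  proof -
    have "n \<in> {0, -1, -2}" if "\<forall>j. ?f n \<le> ?f j" for n
      using sq_dist_not_least [of n] that by (meson linorder_not_le)
    moreover have "?f n \<le> ?f j" if "\<forall>j \<in> {0, -1, -2}. ?f n \<le> ?f j" for n j
      using sq_dist_not_least [of j] that by (cases "j \<in> {0, -1, -2}") force+
    ultimately show ?thesis by blast
  qed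
  also have "\<dots> = \<nu> ` I"
  proof -
    have "m * (k * pi) = 2 * (a - b) * (c - d)" using k by (simp add: m)
    then have 1: "?f 0 - ?f (-1) = k * pi * (\<theta> - pi / 4 - m)"
      and 2: "?f (-2) - ?f (-1) = k * pi * (pi - \<theta> - pi / 4 - m)"
      and 3: "?f 0 - ?f (-2) = k * pi * (2 * \<theta> - pi)"
      by (simp_all add: sq_dist_def power2_eq_square field_simps)
    have le: "x \<le> y \<longleftrightarrow> z \<le> 0" "y \<le> x \<longleftrightarrow> 0 \<le> z" if "x - y = k * pi * z" for x y z
    proof -
      have "x \<le> y \<longleftrightarrow> k * pi * z \<le> 0" "y \<le> x \<longleftrightarrow> 0 \<le> k * pi * z"
        unfolding that [symmetric] by auto
      moreover have pos: "k * pi > 0" using k by simp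
      ultimately show "x \<le> y \<longleftrightarrow> z \<le> 0" "y \<le> x \<longleftrightarrow> 0 \<le> z"
        using mult_le_cancel_left_pos [OF pos, of z 0] mult_le_cancel_left_pos [OF pos, of 0 z]
        by (simp_all only: mult_zero_right)
    qed
    have "?f 0 \<le> ?f (-1) \<longleftrightarrow> \<theta> - pi / 4 \<le> m" "?f (-1) \<le> ?f 0 \<longleftrightarrow> m \<le> \<theta> - pi / 4"
      "?f (-2) \<le> ?f (-1) \<longleftrightarrow> pi - \<theta> - pi / 4 \<le> m" "?f (-1) \<le> ?f (-2) \<longleftrightarrow> m \<le> pi - \<theta> - pi / 4"
      "?f 0 \<le> ?f (-2) \<longleftrightarrow> \<theta> \<le> pi / 2" "?f (-2) \<le> ?f 0 \<longleftrightarrow> pi / 2 \<le> \<theta>"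
      unfolding le [OF 1] le [OF 2] le [OF 3] by auto
    then have eq: "{n \<in> {0, -1, -2}. \<forall>j \<in> {0, -1, -2}. ?f n \<le> ?f j} =
        {n. n = 0 \<and> \<theta> - pi / 4 \<le> m \<and> \<theta> \<le> pi / 2 \<or> n = -2 \<and> pi - \<theta> - pi / 4 \<le> m \<and> pi / 2 \<le> \<theta> \<or>
          n = -1 \<and> m \<le> \<theta> - pi / 4 \<and> m \<le> pi - \<theta> - pi / 4}"
      by auto
    show ?thesis
      unfolding eq I by (auto simp: \<nu> min_def simp del: One_nat_def split: if_splits)
  qed
  finally show ?thesis .
qed

text \<open>At \<open>t = 1/2\<close> the angles for \<open>0\<close> and \<open>-2\<close> differ by \<open>\<pi>/2\<close>, while the ordered eigenvalues agree and
  are distinct; and the eigenvalues for \<open>-1\<close> form a different set from the one for \<open>0\<close> and \<open>-2\<close>.\<close>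

lemma joining_inj:
  "inj_on (\<lambda>n. restrict (eigF \<circ> joining k (sqrt k * u, a, b) (sqrt k * (u + \<theta>), c, d) n) {0..1}) {0, -1, -2}"
    (is "inj_on ?\<chi> _")
proof -
  \<comment> \<open>The lifts of the midpoints.\<close>
  define p where "p = (\<lambda>n. (1 - 1/2 :: real) *\<^sub>R (sqrt k * u, a, b) + (1/2 :: real) *\<^sub>R turn k n (sqrt k * (u + \<theta>), c, d))"
  have p: "fst (p n) = sqrt k * (u + (\<theta> + n * pi / 2) / 2)"
    "snd (p n) = (if even n then ((a + c) / 2, (b + d) / 2) else ((a + d) / 2, (b + c) / 2))" for n
    by (simp_all add: p_def turn_def field_simps)
  have ne: "?\<chi> n \<noteq> ?\<chi> m" if n: "n \<in> {0, -2}" and m: "m \<in> {0, -1, -2}" and mn: "m \<noteq> n" for m n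
  proof
    assume "?\<chi> n = ?\<chi> m"
    from fun_cong [OF this, of "1/2"] have "eigF (chart k (p n)) = eigF (chart k (p m))"
      by (simp add: joining_def p_def)
    note this [symmetric]
    moreover have "fst (snd (p n)) \<noteq> snd (snd (p n))"
      using n ab cd by (auto simp: p)
    ultimately obtain j where j: "p m = turn k j (p n)"
      using eigF_chart_eq_iff [OF k] by blast
    show False
    proof (cases "m = -1")
      case True
      then have "snd (p m) = ((a + d) / 2, (b + c) / 2)" by (simp add: p)
      then show False
        using n ab cd unfolding j by (auto simp: turn_def p split: if_splits)
    next
      case False
      then have "even m" "even n" using m n by auto
      then have "even j"
        using arg_cong [OF j, of snd] ab cd by (auto simp: turn_def p split: if_splits)
      have "sqrt k * (pi / 4 * (real_of_int m - real_of_int n - 2 * real_of_int j)) = 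
          fst (p m) - fst (turn k j (p n))"
        by (simp add: turn_def p field_simps)
      also have "\<dots> = 0" by (simp add: j)
      finally have "real_of_int m - real_of_int n - 2 * real_of_int j = 0"
        using k by simp
      then have "m - n = 2 * j" by linarith
      then show False using \<open>even j\<close> m n mn False by auto
    qed
  qed
  show ?thesis
  proof (rule inj_onI, rule ccontr)
    fix n m :: int assume "n \<in> {0, -1, -2}" "m \<in> {0, -1, -2}" "?\<chi> n = ?\<chi> m" "n \<noteq> m"
    then show False
      using ne [of n m] ne [of m n] by (cases "n = -1") auto
  qed
qed

end

section \<open>The classification\<close>

theorem mainTheorem1:
  fixes k a b c d \<theta> m :: real
    and U X Y D :: "real^2^2"
    and V \<Lambda> :: "nat \<Rightarrow> real^2^2"
    and dd \<theta>s cs ds :: "nat \<Rightarrow> real"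
    and chi :: "nat \<Rightarrow> real \<Rightarrow> real^2^2"
    and I :: "nat set"
  assumes "k > 0" and "a > b" and "c > d" and "0 \<le> \<theta>" and "\<theta> < pi" and "U \<in> SO"
    and X: "X = U ** diag2 (exp a) (exp b) ** transpose U"
    and Y: "Y = U ** Rot \<theta> ** diag2 (exp c) (exp d) ** transpose (Rot \<theta>) ** transpose U"
    and D: "D = diag2 (exp a) (exp b)"
    and V1: "V 1 = U ** Rot \<theta>" and L1: "\<Lambda> 1 = diag2 (exp c) (exp d)"
    and V2: "V 2 = U ** Rot (\<theta> + pi)" and L2: "\<Lambda> 2 = diag2 (exp c) (exp d)"
    and V3: "V 3 = U ** Rot (\<theta> - pi / 2)" and L3: "\<Lambda> 3 = diag2 (exp d) (exp c)"
    and dd: "\<And>i. dd i = distM k (U, D) (V i, \<Lambda> i)"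
    and m: "m = 2 * (a - b) * (c - d) / (k * pi)"
    and \<theta>s: "\<theta>s 1 = \<theta>" "\<theta>s 2 = \<theta> - pi" "\<theta>s 3 = \<theta> - pi / 2"
    and cs: "cs 1 = c" "cs 2 = c" "cs 3 = d"
    and ds: "ds 1 = d" "ds 2 = d" "ds 3 = c"
    and chi: "\<And>i. chi i = (\<lambda>t\<in>{0..1}. (U ** Rot (\<theta>s i * t))
              ** diag2 (exp ((1 - t) * a + t * cs i)) (exp ((1 - t) * b + t * ds i))
              ** transpose (U ** Rot (\<theta>s i * t)))"
    and I: "I = (if m > min \<theta> (pi - \<theta>) - pi / 4
                 then (if \<theta> < pi / 2 then {1} else if \<theta> = pi / 2 then {1, 2} else {2})
                 else if m = min \<theta> (pi - \<theta>) - pi / 4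
                 then (if \<theta> < pi / 2 then {1, 3} else if \<theta> = pi / 2 then {1, 2, 3} else {2, 3})
                 else {3})"
  shows "(\<forall>X' \<in> SymPos. \<forall>Y' \<in> SymPos. card (eigenvalues X') = 2 \<and> card (eigenvalues Y') = 2 \<longrightarrow>
            (\<exists>a' b' c' d' \<theta>'. \<exists>U' \<in> SO. a' > b' \<and> c' > d' \<and> 0 \<le> \<theta>' \<and> \<theta>' < pi \<and>
               X' = U' ** diag2 (exp a') (exp b') ** transpose U' \<and>
               Y' = U' ** Rot \<theta>' ** diag2 (exp c') (exp d') ** transpose (Rot \<theta>') ** transpose U'))
         \<and> (dd 1)\<^sup>2 = k * \<theta>\<^sup>2 + (a - c)\<^sup>2 + (b - d)\<^sup>2
         \<and> (dd 2)\<^sup>2 = k * (pi - \<theta>)\<^sup>2 + (a - c)\<^sup>2 + (b - d)\<^sup>2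
         \<and> (dd 3)\<^sup>2 = k * (\<theta> - pi / 2)\<^sup>2 + (a - d)\<^sup>2 + (b - c)\<^sup>2
         \<and> (\<forall>i\<in>I. dist_SR k X Y = dd i)
         \<and> MSSR_curves k X Y = chi ` I
         \<and> card (MSSR_curves k X Y) = card I
         \<and> (\<forall>i\<in>I. minimal_pair k X Y (U, D) (V i, \<Lambda> i) \<and>
               (\<forall>\<xi>. MSSR_corresponds k X Y (U, D) (V i, \<Lambda> i) \<xi> \<longleftrightarrow> \<xi> = chi i))"
proof -
  note One_nat_def [simp del]
  obtain u where u: "U = Rot u" using \<open>U \<in> SO\<close> by (auto simp: SO_Rot)
  have k: "k > 0" by fact
  define v where "v = (sqrt k * u, a, b)"
  define w where "w = (sqrt k * (u + \<theta>), c, d)"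
  define \<nu> :: "nat \<Rightarrow> int" where "\<nu> = (\<lambda>i. if i = 1 then 0 else if i = 2 then -2 else -1)"
  have \<nu>: "\<nu> 1 = 0" "\<nu> 2 = -2" "\<nu> 3 = -1" by (simp_all add: \<nu>_def)
  have I3: "I \<subseteq> {1, 2, 3}" unfolding I by auto
  have fst_turn: "fst (turn k (\<nu> i) w) / sqrt k = u + \<theta>s i" if "i \<in> {1, 2, 3}" for i
    using that k by (auto simp: \<nu> \<theta>s turn_def w_def field_simps)
  have snd_turn: "snd (turn k (\<nu> i) w) = (cs i, ds i)" if "i \<in> {1, 2, 3}" for i
    using that by (auto simp: \<nu> cs ds turn_def w_def)
  have XF: "X = eigF (chart k v)" 
    using k by (simp add: X u eigF_def chart_def v_def)
  have YF: "Y = eigF (chart k w)"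
    using k by (simp add: Y u eigF_def chart_def w_def Rot_add matrix_transpose_mul matrix_mul_assoc)
  have vne: "fst (snd v) \<noteq> snd (snd v)" and wne: "fst (snd w) \<noteq> snd (snd w)"
    using \<open>a > b\<close> \<open>c > d\<close> by (auto simp: v_def w_def)
  have UD: "(U, D) = chart k v"
    using k by (simp add: chart_def u D v_def)
  have VL: "(V i, \<Lambda> i) = chart k (turn k (\<nu> i) w)" if i: "i \<in> {1, 2, 3}" for i
  proof -
    have "Rot (u + (\<theta> + pi)) = Rot (u + (\<theta> - pi))"
      unfolding Rot_eq_iff by (rule exI [of _ 1]) simp
    then have "V i = Rot (u + \<theta>s i)" "\<Lambda> i = diag2 (exp (cs i)) (exp (ds i))"
      using i by (auto simp: V1 V2 V3 L1 L2 L3 u \<theta>s cs ds simp flip: Rot_add)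
    then show ?thesis
      unfolding chart_def fst_turn [OF i] snd_turn [OF i] by simp
  qed
  have sq: "(dd i)\<^sup>2 = sq_dist k a b c d \<theta> (\<nu> i)" if i: "i \<in> {1, 2, 3}" for i
  proof -
    have "fst (turn k (\<nu> i) w) = sqrt k * (u + \<theta>s i)"
      using fst_turn [OF i] k by (simp add: field_simps)
    then have "\<bar>fst v - fst (turn k (\<nu> i) w)\<bar> = sqrt k * \<bar>\<theta>s i\<bar>"
      using k by (simp add: v_def algebra_simps abs_mult)
    also have "\<dots> \<le> sqrt k * pi"
      using i \<open>0 \<le> \<theta>\<close> \<open>\<theta> < pi\<close> k by (intro mult_left_mono) (auto simp: \<theta>s abs_le_iff)
    finally have "dd i = norm (v - turn k (\<nu> i) w)"
      unfolding dd UD VL [OF i] by (rule distM_chart [OF k])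
    then show ?thesis
      by (simp add: v_def w_def norm_diff_turn [OF k])
  qed
  have opt: "optimal k v w = \<nu> ` I"
    unfolding v_def w_def
    by (rule optimal_eq [OF k \<open>a > b\<close> \<open>c > d\<close> \<open>0 \<le> \<theta>\<close> \<open>\<theta> < pi\<close> m I \<nu>])
  have "I \<noteq> {}" unfolding I by auto
  then obtain n where n: "n \<in> optimal k v w" using opt by blast
  have chi': "chi i = restrict (eigF \<circ> joining k v w (\<nu> i)) {0..1}" if i: "i \<in> {1, 2, 3}" for i
  proof -
    have "eigF (joining k v w (\<nu> i) t) = (U ** Rot (\<theta>s i * t))
              ** diag2 (exp ((1 - t) * a + t * cs i)) (exp ((1 - t) * b + t * ds i))
              ** transpose (U ** Rot (\<theta>s i * t))" for t
    proof -
      have "fst ((1 - t) *\<^sub>R v + t *\<^sub>R turn k (\<nu> i) w) / sqrt k = (1 - t) * u + t * (u + \<theta>s i)"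
        using fst_turn [OF i, symmetric] k by (simp add: v_def add_divide_distrib)
      also have "\<dots> = u + \<theta>s i * t" by (simp add: algebra_simps)
      finally show ?thesis
        using snd_turn [OF i] by (simp add: joining_def chart_def eigF_def v_def u Rot_add)
    qed
    then show ?thesis unfolding chi by (auto simp: restrict_def)
  qed
  have curves: "MSSR_curves k X Y = chi ` I"
    unfolding MSSR_curves_optimal [OF k vne wne XF YF n] opt image_image
    using I3 chi' by (intro image_cong) auto
  have "inj_on (\<lambda>n. restrict (eigF \<circ> joining k v w n) {0..1}) (\<nu> ` {1, 2, 3})"
    unfolding v_def w_def
    using joining_inj [OF k \<open>a > b\<close> \<open>c > d\<close> \<open>0 \<le> \<theta>\<close> \<open>\<theta> < pi\<close>, of u]
    by (rule inj_on_subset) (auto simp: \<nu>)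
  moreover have "inj_on \<nu> {1, 2, 3}" by (auto simp: \<nu>_def inj_on_def)
  ultimately have "inj_on ((\<lambda>n. restrict (eigF \<circ> joining k v w n) {0..1}) \<circ> \<nu>) {1, 2, 3}"
    by (intro comp_inj_on)
  then have "inj_on chi {1, 2, 3}"
    by (rule inj_on_cong [THEN iffD1, rotated]) (use chi' in auto)
  then have card: "card (chi ` I) = card I"
    by (intro card_image) (rule inj_on_subset [OF _ I3])
  have all: "dist_SR k X Y = dd i \<and> minimal_pair k X Y (U, D) (V i, \<Lambda> i) \<and>
     (\<forall>\<xi>. MSSR_corresponds k X Y (U, D) (V i, \<Lambda> i) \<xi> \<longleftrightarrow> \<xi> = chi i)" if "i \<in> I" for i
  proof -
    have i: "i \<in> {1, 2, 3}" and opt_i: "\<nu> i \<in> optimal k v w"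
      using that I3 opt by auto
    have "j = \<nu> i" if "j \<in> optimal k v w" "4 dvd j - \<nu> i" for j
    proof -
      have "j \<in> {0, -1, -2}" "\<nu> i \<in> {0, -1, -2}" using that(1) opt i I3 by (auto simp: \<nu>)
      then show ?thesis using that(2) by (auto simp: dvd_def) presburger+
    qed
    then show ?thesis
      using optimal_dist_SR [OF k vne wne XF YF opt_i]
        minimal_geodesic_joining [OF k vne wne XF YF opt_i]
        MSSR_corresponds_optimal [OF k vne wne XF YF opt_i]
      unfolding dd UD VL [OF i] chi' [OF i] minimal_pair_def
      by (auto simp: joining_def intro!: exI [of _ "joining k v w (\<nu> i)"])
  qed
  show ?thesis
  proof (intro conjI)
    show "(dd 1)\<^sup>2 = k * \<theta>\<^sup>2 + (a - c)\<^sup>2 + (b - d)\<^sup>2"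
      using sq [of 1] by (simp add: sq_dist_def \<nu>)
    show "(dd 2)\<^sup>2 = k * (pi - \<theta>)\<^sup>2 + (a - c)\<^sup>2 + (b - d)\<^sup>2"
      using sq [of 2] by (simp add: sq_dist_def \<nu> power2_commute)
    show "(dd 3)\<^sup>2 = k * (\<theta> - pi / 2)\<^sup>2 + (a - d)\<^sup>2 + (b - c)\<^sup>2"
      using sq [of 3] by (simp add: sq_dist_def \<nu>)
  qed (use SymPos_pair_decomposition all curves card in auto)
qed

end
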